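(* There exists a numerically stable fixed-parameter OBABO tuning rule $(K,L,d)\mapsto(h_{K,L,d},\gamma_{K,L,d})$ such that, for every $\kappa>1$, every $d\ge1$, and every $U\in\mathcal U_\kappa^d$, the kernel $Q=Q_{h,\gamma}^U$ with $(h,\gamma)=(h_{1,\kappa,d},\gamma_{1,\kappa,d})$ has a unique invariant law $\pi$, and for every $z\in\mathbb R^d\times\mathbb R^d$ and every integer $n\ge0$, $$\|\delta_zQ^n-\pi\|_{\mathrm{TV}}\le C\kappa\bigl(1+W_2(\delta_z,\pi)\bigr)\exp\!\left(-\frac{cn}{\kappa}\right),\qquad C=143,\quad c=\frac{1}{128(1-e^{-1})}.$$
   Context: OBABO chain. For a differentiable $U:\mathbb R^d\to\mathbb R$ and $h,\gamma>0$, put $r=e^{-\gamma h/2}$, $\beta=r^2=e^{-\gamma h}$, $\sigma=(1-\beta)^{1/2}$. One OBABO step maps $(x,v)\in\mathbb R^d\times\mathbb R^d$ to $(x^+,v^+)$ by $v^{(a)}=rv+\sigma\xi^{(1)}$, $v^{(b)}=v^{(a)}-\frac h2\nabla U(x)$, $x^+=x+hv^{(b)}$, $v^{(c)}=v^{(b)}-\frac h2\nabla U(x^+)$, $v^+=rv^{(c)}+\sigma\xi^{(2)}$, where $\xi^{(1)},\xi^{(2)}$ are independent $\mathcal N(0,\mathrm{Id}_d)$. Iterating with i.i.d. copies of $(\xi^{(1)},\xi^{(2)})$ defines a Markov chain with transition kernel $Q_{h,\gamma}^U$. $\mathcal U_\kappa^d=\{U\in C^\infty(\mathbb R^d): \mathrm{Id}_d\preceq\nabla^2U(x)\preceq\kappa\,\mathrm{Id}_d\text{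 for every }x\}$. A fixed-parameter tuning rule assigns to each triple $(K,L,d)$ with $0<K<L$ and integer $d\ge1$ a pair $(h_{K,L,d},\gamma_{K,L,d})\in(0,\infty)^2$. It is numerically stable if $0<h_{K,L,d}<2/\sqrt L$ for every $0<K<L$ and $d\ge1$. $\|\nu-\widetilde\nu\|_{\mathrm{TV}}=\sup_A|\nu(A)-\widetilde\nu(A)|$; $W_2$ is the Euclidean $2$-Wasserstein distance; $\delta_z$ is the Dirac mass at $z$. *)

theory Defs
  imports "HOL-Probability.Probability"
begin

text \<open>
  The dimension is quantified inside the theorem, after the tuning rule, so it has to be a
  number and not a type. The space of dimension \<open>d\<close> is the set of extensional functions on
  \<open>{..<d}\<close>. The topology of the type \<open>nat \<Rightarrow> real\<close> is the product topology; on this set it is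
  the Euclidean one, and the product sigma-algebra is the Borel one.
\<close>

definition Rd :: "nat \<Rightarrow> (nat \<Rightarrow> real) set" where
  "Rd d = (\<Pi>\<^sub>E i\<in>{..<d}. UNIV)"

definition borel_Rd :: "nat \<Rightarrow> (nat \<Rightarrow> real) measure" where
  "borel_Rd d = (\<Pi>\<^sub>M i\<in>{..<d}. borel)"

definition std_gaussian :: "nat \<Rightarrow> (nat \<Rightarrow> real) measure" where
  "std_gaussian d = (\<Pi>\<^sub>M i\<in>{..<d}. density lborel std_normal_density)"

type_synonym phase_point = "(nat \<Rightarrow> real) \<times> (nat \<Rightarrow> real)"

definition phase :: "nat \<Rightarrow> phase_point measure" where
  "phase d = borel_Rd d \<Otimes>\<^sub>M borel_Rd d"

definition phase_dist :: "nat \<Rightarrow> phase_point \<Rightarrow> phase_point \<Rightarrow> real" where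
  "phase_dist d z z' =
     sqrt ((\<Sum>i<d. (fst z i - fst z' i)\<^sup>2) + (\<Sum>i<d. (snd z i - snd z' i)\<^sup>2))"

definition partial :: "nat \<Rightarrow> ((nat \<Rightarrow> real) \<Rightarrow> real) \<Rightarrow> (nat \<Rightarrow> real) \<Rightarrow> real" where
  "partial i f x = deriv (\<lambda>t. f (x(i := t))) (x i)"

definition has_partials :: "nat \<Rightarrow> ((nat \<Rightarrow> real) \<Rightarrow> real) \<Rightarrow> bool" where
  "has_partials d f \<longleftrightarrow>
     (\<forall>i<d. \<forall>x\<in>Rd d. (\<lambda>t. f (x(i := t))) field_differentiable at (x i))"

fun C_k :: "nat \<Rightarrow> nat \<Rightarrow> ((nat \<Rightarrow> real) \<Rightarrow> real) \<Rightarrow> bool" where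
  "C_k d 0 f \<longleftrightarrow> continuous_on (Rd d) f"
| "C_k d (Suc k) f \<longleftrightarrow>
     continuous_on (Rd d) f \<and> has_partials d f \<and> (\<forall>i<d. C_k d k (partial i f))"

definition C_infinity :: "nat \<Rightarrow> ((nat \<Rightarrow> real) \<Rightarrow> real) \<Rightarrow> bool" where
  "C_infinity d f \<longleftrightarrow> (\<forall>k. C_k d k f)"

definition gradient :: "((nat \<Rightarrow> real) \<Rightarrow> real) \<Rightarrow> (nat \<Rightarrow> real) \<Rightarrow> (nat \<Rightarrow> real)" where
  "gradient f x = (\<lambda>i. partial i f x)"

definition hessian :: "((nat \<Rightarrow> real) \<Rightarrow> real) \<Rightarrow> (nat \<Rightarrow> real) \<Rightarrow> nat \<Rightarrow> nat \<Rightarrow> real" where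
  "hessian f x = (\<lambda>i j. partial i (partial j f) x)"

definition scaled_id :: "real \<Rightarrow> nat \<Rightarrow> nat \<Rightarrow> real" where
  "scaled_id c = (\<lambda>i j. if i = j then c else 0)"

text \<open>
  The order on symmetric matrices: \<open>B - A\<close> is positive semidefinite. Symmetry is not part of
  the definition; the Hessian of a smooth function and the multiples of the identity have it.
\<close>

definition loewner_le :: "nat \<Rightarrow> (nat \<Rightarrow> nat \<Rightarrow> real) \<Rightarrow> (nat \<Rightarrow> nat \<Rightarrow> real) \<Rightarrow> bool" where
  "loewner_le d A B \<longleftrightarrow> (\<forall>w\<in>Rd d. 0 \<le> (\<Sum>i<d. \<Sum>j<d. w i * (B i j - A i j) * w j))"

definition U_class :: "real \<Rightarrow> nat \<Rightarrow> ((nat \<Rightarrow> real) \<Rightarrow> real) set" where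
  "U_class \<kappa> d = {U. C_infinity d U \<and>
     (\<forall>x\<in>Rd d. loewner_le d (scaled_id 1) (hessian U x) \<and>
                loewner_le d (hessian U x) (scaled_id \<kappa>))}"

definition obabo_step ::
  "nat \<Rightarrow> ((nat \<Rightarrow> real) \<Rightarrow> real) \<Rightarrow> real \<Rightarrow> real \<Rightarrow> phase_point \<Rightarrow> phase_point \<Rightarrow> phase_point" where
  "obabo_step d U h \<gamma> = (\<lambda>(x, v) (\<xi>\<^sub>1, \<xi>\<^sub>2).
     let r = exp (- \<gamma> * h / 2);
         \<beta> = r\<^sup>2;
         \<sigma> = sqrt (1 - \<beta>);
         va = (\<lambda>i\<in>{..<d}. r * v i + \<sigma> * \<xi>\<^sub>1 i);
         vb = (\<lambda>i\<in>{..<d}. va i - h / 2 * gradient U x i);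
         x' = (\<lambda>i\<in>{..<d}. x i + h * vb i);
         vc = (\<lambda>i\<in>{..<d}. vb i - h / 2 * gradient U x' i);
         v' = (\<lambda>i\<in>{..<d}. r * vc i + \<sigma> * \<xi>\<^sub>2 i)
     in (x', v'))"

definition obabo_kernel ::
  "nat \<Rightarrow> ((nat \<Rightarrow> real) \<Rightarrow> real) \<Rightarrow> real \<Rightarrow> real \<Rightarrow> phase_point \<Rightarrow> phase_point measure" where
  "obabo_kernel d U h \<gamma> z =
     distr (std_gaussian d \<Otimes>\<^sub>M std_gaussian d) (phase d) (obabo_step d U h \<gamma> z)"

definition push :: "('a \<Rightarrow> 'a measure) \<Rightarrow> nat \<Rightarrow> 'a measure \<Rightarrow> 'a measure" where
  "push Q n \<mu> = ((\<lambda>\<nu>. \<nu> \<bind> Q) ^^ n) \<mu>"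

definition invariant_law :: "'a measure \<Rightarrow> ('a \<Rightarrow> 'a measure) \<Rightarrow> 'a measure \<Rightarrow> bool" where
  "invariant_law M Q \<pi> \<longleftrightarrow> prob_space \<pi> \<and> sets \<pi> = sets M \<and> \<pi> \<bind> Q = \<pi>"

definition tv_dist :: "'a measure \<Rightarrow> 'a measure \<Rightarrow> real" where
  "tv_dist \<mu> \<nu> = (SUP A\<in>sets \<mu>. \<bar>measure \<mu> A - measure \<nu> A\<bar>)"

definition couplings :: "'a measure \<Rightarrow> 'a measure \<Rightarrow> ('a \<times> 'a) measure set" where
  "couplings \<mu> \<nu> = {\<rho>. prob_space \<rho> \<and> sets \<rho> = sets (\<mu> \<Otimes>\<^sub>M \<nu>) \<and>
     distr \<rho> \<mu> fst = \<mu> \<and> distr \<rho> \<nu> snd = \<nu>}"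

text \<open>
  The distance takes values in the extended nonnegative reals: it is infinite when no coupling
  has finite cost. The last step is the square root on that type.
\<close>

definition W2_cost :: "nat \<Rightarrow> phase_point measure \<Rightarrow> phase_point measure \<Rightarrow> ennreal" where
  "W2_cost d \<mu> \<nu> =
     (INF \<rho>\<in>couplings \<mu> \<nu>. \<integral>\<^sup>+ (z, z'). ennreal ((phase_dist d z z')\<^sup>2) \<partial>\<rho>)"

definition W2 :: "nat \<Rightarrow> phase_point measure \<Rightarrow> phase_point measure \<Rightarrow> ennreal" where
  "W2 d \<mu> \<nu> =
     (if W2_cost d \<mu> \<nu> = \<infinity> then \<infinity> else ennreal (sqrt (enn2real (W2_cost d \<mu> \<nu>))))"

text \<open>A rule sends \<open>K\<close>, \<open>L\<close>, \<open>d\<close> to the pair of the step size and the friction.\<close>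

type_synonym tuning = "real \<Rightarrow> real \<Rightarrow> nat \<Rightarrow> real \<times> real"

definition tuning_rule :: "tuning \<Rightarrow> bool" where
  "tuning_rule R \<longleftrightarrow>
     (\<forall>K L d. 0 < K \<and> K < L \<and> 1 \<le> d \<longrightarrow> 0 < fst (R K L d) \<and> 0 < snd (R K L d))"

definition numerically_stable :: "tuning \<Rightarrow> bool" where
  "numerically_stable R \<longleftrightarrow>
     (\<forall>K L d. 0 < K \<and> K < L \<and> 1 \<le> d \<longrightarrow> 0 < fst (R K L d) \<and> fst (R K L d) < 2 / sqrt L)"

end

theory Submission
  imports Defs
begin

text \<open>
  The tuning makes the chain a small perturbation of the unadjusted Langevin algorithm. With step
  size \<open>h = 1 / sqrt \<kappa>\<close> and a friction such that \<open>r = exp (- \<gamma> * h / 2) = 1 / (4 * \<kappa>)\<close>, the velocity is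
  almost completely refreshed in each step, and the position makes a gradient step of length
  \<open>h\<^sup>2 / 2 = 1 / (2 * \<kappa>)\<close> plus Gaussian noise. A gradient step of length \<open>t \<le> 1 / \<kappa>\<close> contracts by
  \<open>1 - t\<close>, by the cocoercivity of the gradient of \<open>U - \<bar>x\<bar>\<^sup>2 / 2\<close> (\<open>gradient_step_contracts\<close>). The
  remaining influence of the velocity is of order \<open>r\<close>. Hence, in a distance that weights velocities by
  \<open>h\<close>, two copies of the chain with the same noise approach each other by the factor
  \<open>1 - 1 / (4 * \<kappa>)\<close> in every step, for every value of the noise (\<open>step_contracts\<close>).

  One step also turns distance into total variation. The step from one point with noise \<open>\<xi>\<close> is
  the step from another point with a translated noise, and the translation does not depend on
  \<open>\<xi>\<close>. The total variation distance of two kernels is therefore at most that of a Gaussian law and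
  its translate, which is bounded by a constant times the length of the translation in every dimension
  (\<open>gaussian_shift_tv\<close>, \<open>kernel_smoothing\<close>).

  These two properties give everything else abstractly (\<open>contractive_random_map\<close>). For each event
  \<open>A\<close>, the function \<open>z \<mapsto> Q\<^sup>n(z, A)\<close> is Lipschitz with a constant of order \<open>\<rho> ^ n\<close>, uniformly
  in \<open>A\<close>. So the laws started at a point whose one-step displacement has a first moment are
  Cauchy in total variation, and their limit is an invariant law. Integrating the Lipschitz bound
  over an invariant law gives the rate, with the mean distance from \<open>z\<close> in front, and that mean is
  at most a constant times \<open>1 + W\<^sub>2\<close> (\<open>expected_dist_le_W2\<close>). Bounded convergence gives uniqueness.
\<close>

section \<open>Laws that converge uniformly on events\<close>

text \<open>
  Countable additivity survives the limit because the convergence is uniform over the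
  events: along a decreasing sequence of events with empty intersection, the limit exceeds
  a fixed \<open>\<mu> n\<close> by at most \<open>b n\<close>, and \<open>\<mu> n\<close> itself is continuous from above.
\<close>
lemma setwise_Cauchy_limit:
  fixes \<mu> :: "nat \<Rightarrow> 'a measure" and M :: "'a measure" and b :: "nat \<Rightarrow> real"
  assumes \<mu>: "\<And>n. \<mu> n \<in> space (prob_algebra M)"
    and b: "b \<longlonglongrightarrow> 0"
    and close: "\<And>A n k. A \<in> sets M \<Longrightarrow> \<bar>measure (\<mu> (n + k)) A - measure (\<mu> n) A\<bar> \<le> b n"
  obtains \<pi> where "\<pi> \<in> space (prob_algebra M)"
    and "\<And>A. A \<in> sets M \<Longrightarrow> (\<lambda>n. measure (\<mu> n) A) \<longlonglongrightarrow> measure \<pi> A"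
proof -
  have P: "prob_space (\<mu> n)" and S[simp]: "sets (\<mu> n) = sets M" for n
    using \<mu>[of n] by (auto simp: space_prob_algebra)
  have sp[simp]: "space (\<mu> n) = space M" for n
    using S by (rule sets_eq_imp_space_eq)
  interpret prob_space "\<mu> n" for n by (rule P)
  have "Cauchy (\<lambda>n. measure (\<mu> n) A)" if A: "A \<in> sets M" for A
  proof (rule metric_CauchyI)
    fix e :: real assume "e > 0"
    then have "\<forall>\<^sub>F n in sequentially. b n < e / 2"
      using b by (intro order_tendstoD(2)[OF b]) auto
    then obtain N where N: "b N < e / 2" by (auto simp: eventually_sequentially)
    have "dist (measure (\<mu> m) A) (measure (\<mu> n) A) < e" if "m \<ge> N" "n \<ge> N" for m n
      using close[OF A, of N "m - N"] close[OF A, of N "n - N"] that N by (auto simp: dist_real_def)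
    then show "\<exists>N. \<forall>m\<ge>N. \<forall>n\<ge>N. dist (measure (\<mu> m) A) (measure (\<mu> n) A) < e" by blast
  qed
  then have lim: "\<exists>l. (\<lambda>n. measure (\<mu> n) A) \<longlonglongrightarrow> l" if "A \<in> sets M" for A
    using that real_Cauchy_convergent by (auto simp: convergent_def)
  define p where "p A = lim (\<lambda>n. measure (\<mu> n) A)" for A
  have p: "(\<lambda>n. measure (\<mu> n) A) \<longlonglongrightarrow> p A" if "A \<in> sets M" for A
    using lim[OF that] unfolding p_def by (metis limI)
  have p_nn: "0 \<le> p A" if "A \<in> sets M" for A
    using p[OF that] by (rule LIMSEQ_le_const) auto
  have p_close: "p A \<le> measure (\<mu> n) A + b n" if "A \<in> sets M" for A n
  proof (rule LIMSEQ_le_const2[OF p[OF that]])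
    show "\<exists>N. \<forall>m\<ge>N. measure (\<mu> m) A \<le> measure (\<mu> n) A + b n"
      using close[OF that, of n] by (intro exI[of _ n] allI impI) (metis abs_le_D1 le_add_diff_inverse diff_le_eq add.commute)
  qed
  have p_Un: "p (A \<union> B) = p A + p B" if AB: "A \<in> sets M" "B \<in> sets M" "A \<inter> B = {}" for A B
  proof (rule LIMSEQ_unique[OF p])
    have "(\<lambda>n. measure (\<mu> n) A + measure (\<mu> n) B) \<longlonglongrightarrow> p A + p B"
      by (intro tendsto_add p AB)
    then show "(\<lambda>n. measure (\<mu> n) (A \<union> B)) \<longlonglongrightarrow> p A + p B"
      using AB by (subst finite_measure_Union) auto
  qed (use AB in auto)
  have p_space: "p (space M) = 1"
  proof (rule LIMSEQ_unique[OF p])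
    have "measure (\<mu> n) (space M) = 1" for n using prob_space[of n] by simp
    then show "(\<lambda>n. measure (\<mu> n) (space M)) \<longlonglongrightarrow> 1" by simp
  qed simp
  have p_empty: "p {} = 0" using p[of "{}"] by (simp add: LIMSEQ_const_iff)
  define \<pi> where "\<pi> = measure_of (space M) (sets M) (\<lambda>A. ennreal (p A))"
  have ca: "countably_additive (sets M) (\<lambda>A. ennreal (p A))"
  proof (rule sets.empty_continuous_imp_countably_additive)
    show "positive (sets M) (\<lambda>A. ennreal (p A))" by (simp add: positive_def p_empty)
    show "additive (sets M) (\<lambda>A. ennreal (p A))"
      by (auto simp: additive_def p_Un p_nn ennreal_plus)
    fix A :: "nat \<Rightarrow> 'a set"
    assume A: "range A \<subseteq> sets M" "decseq A" "(\<Inter>i. A i) = {}"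
    have AM: "A i \<in> sets M" for i using A by auto
    have "(\<lambda>i. p (A i)) \<longlonglongrightarrow> 0"
    proof (rule LIMSEQ_I)
      fix e :: real assume "e > 0"
      then have "\<forall>\<^sub>F n in sequentially. b n < e / 2"
        by (intro order_tendstoD(2)[OF b]) auto
      then obtain n where n: "b n < e / 2" by (auto simp: eventually_sequentially)
      have "(\<lambda>i. measure (\<mu> n) (A i)) \<longlonglongrightarrow> measure (\<mu> n) (\<Inter>i. A i)"
        using A by (intro finite_Lim_measure_decseq) auto
      then have "(\<lambda>i. measure (\<mu> n) (A i)) \<longlonglongrightarrow> 0" using A by simp
      then have "\<forall>\<^sub>F i in sequentially. measure (\<mu> n) (A i) < e / 2"
        using \<open>e > 0\<close> by (intro order_tendstoD(2)) auto
      then obtain N where N: "\<And>i. i \<ge> N \<Longrightarrow> measure (\<mu> n) (A i) < e / 2"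
        by (auto simp: eventually_sequentially)
      have "norm (p (A i) - 0) < e" if "i \<ge> N" for i
        using p_close[OF AM, of i n] p_nn[OF AM, of i] N[OF that] n by auto
      then show "\<exists>N. \<forall>i\<ge>N. norm (p (A i) - 0) < e" by blast
    qed
    then show "(\<lambda>i. ennreal (p (A i))) \<longlonglongrightarrow> 0"
      using tendsto_ennrealI by fastforce
  qed simp
  have em: "emeasure \<pi> A = ennreal (p A)" if "A \<in> sets M" for A
    unfolding \<pi>_def
    by (rule emeasure_measure_of_sigma[OF sets.sigma_algebra_axioms _ ca that])
       (simp add: positive_def p_empty)
  have sets_\<pi>: "sets \<pi> = sets M" unfolding \<pi>_def by simp
  then have "space \<pi> = space M" by (rule sets_eq_imp_space_eq)
  then have "prob_space \<pi>"
    by (intro prob_spaceI) (simp add: em p_space)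
  show thesis
  proof
    show "\<pi> \<in> space (prob_algebra M)"
      using \<open>prob_space \<pi>\<close> sets_\<pi> by (simp add: space_prob_algebra)
    show "(\<lambda>n. measure (\<mu> n) A) \<longlonglongrightarrow> measure \<pi> A" if "A \<in> sets M" for A
      using p[OF that] em[OF that] p_nn[OF that] by (simp add: measure_def)
  qed
qed

text \<open>
  Expresses an integral through the measures of events alone, so that convergence on
  events can be turned into convergence of integrals by dominated convergence in \<open>t\<close>.
\<close>
lemma nn_integral_layer_cake:
  fixes f :: "'a \<Rightarrow> real"
  assumes "sigma_finite_measure M" and f[measurable]: "f \<in> borel_measurable M"
  shows "(\<integral>\<^sup>+x. ennreal (f x) \<partial>M) = (\<integral>\<^sup>+t. indicator {0..} t * emeasure M {x \<in> space M. t < f x} \<partial>lborel)"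
proof -
  interpret sigma_finite_measure M by fact
  interpret pair_sigma_finite M lborel ..
  let ?g = "\<lambda>x t. indicator {t. 0 \<le> t \<and> t < f x} t :: ennreal"
  have "(\<integral>\<^sup>+x. ennreal (f x) \<partial>M) = (\<integral>\<^sup>+x. (\<integral>\<^sup>+t. ?g x t \<partial>lborel) \<partial>M)"
  proof (intro nn_integral_cong)
    fix x
    have "{t. 0 \<le> t \<and> t < f x} = {0..<f x}" by auto
    moreover have "emeasure lborel {0..<f x} = ennreal (f x)"
      by (cases "0 \<le> f x") (auto simp: ennreal_neg)
    ultimately show "ennreal (f x) = (\<integral>\<^sup>+t. ?g x t \<partial>lborel)" by simp
  qed
  also have "\<dots> = (\<integral>\<^sup>+t. (\<integral>\<^sup>+x. ?g x t \<partial>M) \<partial>lborel)"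
    by (rule Fubini'[symmetric]) (simp add: indicator_def)
  also have "\<dots> = (\<integral>\<^sup>+t. indicator {0..} t * emeasure M {x \<in> space M. t < f x} \<partial>lborel)"
  proof (intro nn_integral_cong)
    fix t :: real
    have "(\<integral>\<^sup>+x. ?g x t \<partial>M) = (\<integral>\<^sup>+x. indicator {0..} t * indicator {x \<in> space M. t < f x} x \<partial>M)"
      by (intro nn_integral_cong) (auto simp: indicator_def)
    also have "\<dots> = indicator {0..} t * emeasure M {x \<in> space M. t < f x}"
      by (subst nn_integral_cmult) auto
    finally show "(\<integral>\<^sup>+x. ?g x t \<partial>M) = indicator {0..} t * emeasure M {x \<in> space M. t < f x}" .
  qed
  finally show ?thesis .
qed

lemma setwise_limit_nn_integral:
  fixes f :: "'a \<Rightarrow> real"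
  assumes \<mu>: "\<And>n. \<mu> n \<in> space (prob_algebra M)" and \<pi>: "\<pi> \<in> space (prob_algebra M)"
    and lim: "\<And>A. A \<in> sets M \<Longrightarrow> (\<lambda>n. measure (\<mu> n) A) \<longlonglongrightarrow> measure \<pi> A"
    and f: "f \<in> borel_measurable M" and f1: "\<And>x. x \<in> space M \<Longrightarrow> f x \<le> 1"
  shows "(\<lambda>n. \<integral>\<^sup>+x. ennreal (f x) \<partial>\<mu> n) \<longlonglongrightarrow> (\<integral>\<^sup>+x. ennreal (f x) \<partial>\<pi>)"
proof -
  let ?G = "\<lambda>\<nu> t. indicator {0..} t * emeasure \<nu> {x \<in> space M. t < f x} :: ennreal"
  have facts: "prob_space \<nu> \<and> sets \<nu> = sets M \<and> space \<nu> = space M \<and> f \<in> borel_measurable \<nu>"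
    if "\<nu> \<in> space (prob_algebra M)" for \<nu>
  proof -
    have "sets \<nu> = sets M" "prob_space \<nu>" using that by (simp_all add: space_prob_algebra)
    then show ?thesis
      using f measurable_cong_sets[of \<nu> M borel borel] sets_eq_imp_space_eq[of \<nu> M] by simp
  qed
  have cake: "(\<integral>\<^sup>+x. ennreal (f x) \<partial>\<nu>) = (\<integral>\<^sup>+t. ?G \<nu> t \<partial>lborel)"
    if "\<nu> \<in> space (prob_algebra M)" for \<nu>
    using nn_integral_layer_cake[of \<nu> f] facts[OF that]
    by (simp add: prob_space_imp_sigma_finite)
  have meas: "?G \<nu> \<in> borel_measurable lborel" if "\<nu> \<in> space (prob_algebra M)" for \<nu>
  proof -
    have [measurable]: "f \<in> borel_measurable \<nu>" using facts[OF that] by simp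
    interpret sigma_finite_measure \<nu> using facts[OF that] by (simp add: prob_space_imp_sigma_finite)
    have "(\<lambda>t. emeasure \<nu> {x \<in> space \<nu>. t < f x}) \<in> borel_measurable lborel"
      by measurable
    then show ?thesis using facts[OF that] by simp
  qed
  have "(\<lambda>n. \<integral>\<^sup>+t. ?G (\<mu> n) t \<partial>lborel) \<longlonglongrightarrow> (\<integral>\<^sup>+t. ?G \<pi> t \<partial>lborel)"
  proof (rule nn_integral_dominated_convergence[where w = "indicator {0..1}"])
    show "?G (\<mu> n) \<in> borel_measurable lborel" for n by (rule meas[OF \<mu>])
    show "?G \<pi> \<in> borel_measurable lborel" by (rule meas[OF \<pi>])
    show "AE t in lborel. ?G (\<mu> n) t \<le> indicator {0..1} t" for n
    proof (rule AE_I2)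
      fix t :: real
      show "?G (\<mu> n) t \<le> indicator {0..1} t"
      proof (cases "t > 1")
        case True
        then have "{x \<in> space M. t < f x} = {}" using f1 by force
        then show ?thesis by (simp only: emeasure_empty) simp
      next
        case False
        moreover have "emeasure (\<mu> n) X \<le> 1" for X
          using facts[OF \<mu>] by (simp add: prob_space.emeasure_le_1)
        ultimately show ?thesis by (simp add: indicator_def)
      qed
    qed
    show "AE t in lborel. (\<lambda>n. ?G (\<mu> n) t) \<longlonglongrightarrow> ?G \<pi> t"
    proof (rule AE_I2)
      fix t :: real
      have "{x \<in> space M. t < f x} \<in> sets M" using f by measurable
      then have "(\<lambda>n. ennreal (measure (\<mu> n) {x \<in> space M. t < f x}))
          \<longlonglongrightarrow> ennreal (measure \<pi> {x \<in> space M. t < f x})"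
        by (intro tendsto_ennrealI lim)
      then have "(\<lambda>n. emeasure (\<mu> n) {x \<in> space M. t < f x})
          \<longlonglongrightarrow> emeasure \<pi> {x \<in> space M. t < f x}"
        using facts \<mu> \<pi>
        by (simp add: finite_measure.emeasure_eq_measure prob_space.finite_measure)
      then show "(\<lambda>n. ?G (\<mu> n) t) \<longlonglongrightarrow> ?G \<pi> t"
        by (cases "0 \<le> t") (auto simp: indicator_def)
    qed
  qed auto
  then show ?thesis by (simp add: cake[OF \<mu>] cake[OF \<pi>])
qed


section \<open>Chains driven by contracting random maps\<close>

lemma push_0 [simp]: "push R 0 \<mu> = \<mu>"
  by (simp add: push_def)

lemma push_Suc: "push R (Suc n) \<mu> = push R n \<mu> \<bind> R"
  by (simp add: push_def)

text \<open>
  A chain \<open>z \<mapsto> \<Phi> z \<xi>\<close> driven by independent noise \<open>\<xi>\<close> with law \<open>G\<close>. The contraction holds for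
  every value of the noise, so running two copies with the same noise brings them together
  at rate \<open>\<rho>\<close>. The smoothing hypothesis turns a small distance into a small total variation
  distance in a single step. The first moment at one point gives the convergence that
  produces an invariant law.
\<close>
locale contractive_random_map =
  fixes M :: "'a measure" and G :: "'b measure" and \<Phi> :: "'a \<Rightarrow> 'b \<Rightarrow> 'a"
    and N :: "'a \<Rightarrow> 'a \<Rightarrow> real" and \<rho> K :: real and z\<^sub>0 :: 'a
  assumes prob_G: "prob_space G"
    and \<Phi>_measurable: "(\<lambda>(z, \<xi>). \<Phi> z \<xi>) \<in> M \<Otimes>\<^sub>M G \<rightarrow>\<^sub>M M"
    and N_nonneg: "\<And>z w. 0 \<le> N z w"
    and N_measurable: "\<And>z. z \<in> space M \<Longrightarrow> N z \<in> borel_measurable M"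
    and contraction: "\<And>z w \<xi>. z \<in> space M \<Longrightarrow> w \<in> space M \<Longrightarrow> \<xi> \<in> space G \<Longrightarrow>
      N (\<Phi> z \<xi>) (\<Phi> w \<xi>) \<le> \<rho> * N z w"
    and \<rho>: "0 \<le> \<rho>" "\<rho> < 1" and K: "0 \<le> K"
    and smoothing: "\<And>z w A. z \<in> space M \<Longrightarrow> w \<in> space M \<Longrightarrow> A \<in> sets M \<Longrightarrow>
      \<bar>measure (distr G M (\<Phi> z)) A - measure (distr G M (\<Phi> w)) A\<bar> \<le> K * N z w"
    and z\<^sub>0: "z\<^sub>0 \<in> space M"
    and moment: "integrable G (\<lambda>\<xi>. N z\<^sub>0 (\<Phi> z\<^sub>0 \<xi>))"
begin

sublocale G: prob_space G by (rule prob_G)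

definition Q :: "'a \<Rightarrow> 'a measure" where
  "Q z = distr G M (\<Phi> z)"

definition P :: "nat \<Rightarrow> 'a \<Rightarrow> 'a measure" where
  "P n z = push Q n (return M z)"

lemma \<Phi>_measurable1: "z \<in> space M \<Longrightarrow> \<Phi> z \<in> G \<rightarrow>\<^sub>M M"
  using measurable_compose[OF measurable_Pair1' \<Phi>_measurable] by simp

lemma \<Phi>_space: "z \<in> space M \<Longrightarrow> \<xi> \<in> space G \<Longrightarrow> \<Phi> z \<xi> \<in> space M"
  using \<Phi>_measurable1 by (rule measurable_space)

lemma Q_measurable: "Q \<in> M \<rightarrow>\<^sub>M prob_algebra M"
proof -
  have "(\<lambda>z. distr G M (\<Phi> z)) \<in> M \<rightarrow>\<^sub>M prob_algebra M"
    using \<Phi>_measurable prob_G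
    by (intro measurable_distr_prob_space2[where M = G] measurable_const)
       (auto simp: space_prob_algebra)
  then show ?thesis by (simp add: Q_def[abs_def])
qed

lemma P_measurable: "P n \<in> M \<rightarrow>\<^sub>M prob_algebra M"
proof (induction n)
  case 0
  then show ?case by (simp add: P_def[abs_def])
next
  case (Suc n)
  then show ?case
    using measurable_bind_prob_space[OF Suc Q_measurable]
    by (simp add: P_def[abs_def] push_Suc)
qed

lemma P_space: "z \<in> space M \<Longrightarrow> P n z \<in> space (prob_algebra M)"
  using P_measurable by (rule measurable_space)

lemma P_sets [simp]: "z \<in> space M \<Longrightarrow> sets (P n z) = sets M"
  and P_prob: "z \<in> space M \<Longrightarrow> prob_space (P n z)"
  using P_space by (auto simp: space_prob_algebra)

lemma P_measure_measurable: "A \<in> sets M \<Longrightarrow> (\<lambda>z. measure (P n z) A) \<in> borel_measurable M"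
  by (rule measurable_compose[OF P_measurable measurable_measure_prob_algebra])

text \<open>
  The powers of the kernel are built by adding a last step; this lets the first step be
  split off instead, which is what the recursion in \<open>measure_P_Suc\<close> needs.
\<close>
lemma push_eq_bind:
  assumes "sets \<mu> = sets M"
  shows "push Q n \<mu> = \<mu> \<bind> P n"
proof (induction n)
  case 0
  then show ?case using assms by (simp add: P_def[abs_def] bind_return'')
next
  case (Suc n)
  have "P n \<in> \<mu> \<rightarrow>\<^sub>M subprob_algebra M"
    using measurable_prob_algebraD[OF P_measurable] measurable_cong_sets[OF assms refl] by blast
  then have "\<mu> \<bind> P n \<bind> Q = \<mu> \<bind> (\<lambda>z. P n z \<bind> Q)"
    by (rule bind_assoc) (rule measurable_prob_algebraD[OF Q_measurable])
  then show ?case by (simp add: Suc push_Suc P_def[abs_def])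
qed

lemma measure_bind_P:
  assumes "prob_space \<mu>" "sets \<mu> = sets M" "A \<in> sets M"
  shows "measure (\<mu> \<bind> P n) A = (\<integral>w. measure (P n w) A \<partial>\<mu>)"
proof -
  interpret prob_space \<mu> by fact
  have "P n \<in> \<mu> \<rightarrow>\<^sub>M subprob_algebra M"
    using measurable_prob_algebraD[OF P_measurable] measurable_cong_sets[OF assms(2) refl] by blast
  then show ?thesis using assms by (intro measure_bind) auto
qed

lemma P_1: "z \<in> space M \<Longrightarrow> P (Suc 0) z = Q z"
  using bind_return[OF measurable_prob_algebraD[OF Q_measurable]] by (simp add: P_def push_Suc)

lemma measure_P_Suc:
  assumes "z \<in> space M" "A \<in> sets M"
  shows "measure (P (Suc n) z) A = (\<integral>\<xi>. measure (P n (\<Phi> z \<xi>)) A \<partial>G)"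
proof -
  have "P (Suc n) z = push Q n (Q z)"
    using P_1[OF assms(1)] by (simp add: P_def push_def funpow_Suc_right del: funpow.simps)
  also have "\<dots> = Q z \<bind> P n" by (rule push_eq_bind) (simp add: Q_def)
  finally have "measure (P (Suc n) z) A = (\<integral>w. measure (P n w) A \<partial>Q z)"
    using assms G.prob_space_distr[OF \<Phi>_measurable1[OF assms(1)]]
    by (simp add: measure_bind_P Q_def)
  also have "\<dots> = (\<integral>\<xi>. measure (P n (\<Phi> z \<xi>)) A \<partial>G)"
    unfolding Q_def using assms \<Phi>_measurable1 P_measure_measurable by (intro integral_distr) auto
  finally show ?thesis .
qed

lemma P_integrable:
  assumes "prob_space \<mu>" "sets \<mu> = sets M" "A \<in> sets M"
  shows "integrable \<mu> (\<lambda>w. measure (P n w) A)"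
proof -
  interpret prob_space \<mu> by fact
  have "space \<mu> = space M" using assms by (intro sets_eq_imp_space_eq) simp
  then show ?thesis
    using P_measure_measurable[OF assms(3), of n] P_prob assms
    by (intro integrable_const_bound[where B = 1])
       (auto simp: measurable_cong_sets[OF assms(2) refl] prob_space.prob_le_1)
qed

lemma P_integrable_G:
  assumes "z \<in> space M" "A \<in> sets M"
  shows "integrable G (\<lambda>\<xi>. measure (P n (\<Phi> z \<xi>)) A)"
  using P_integrable[of "distr G M (\<Phi> z)" A n] G.prob_space_distr[OF \<Phi>_measurable1[OF assms(1)]] assms
    integrable_distr_eq[OF \<Phi>_measurable1[OF assms(1)] P_measure_measurable[OF assms(2)]] by simp

text \<open>
  The probability of an event after \<open>n + 1\<close> steps is the \<open>G\<close>-average over the first noise of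
  the probability after \<open>n\<close> steps. Averaging over maps that contract \<open>N\<close> by \<open>\<rho>\<close> multiplies
  the Lipschitz constant by \<open>\<rho>\<close>; the induction starts from the smoothing in one step.
\<close>
lemma P_lipschitz:
  assumes "z \<in> space M" "w \<in> space M" "A \<in> sets M"
  shows "\<bar>measure (P (Suc n) z) A - measure (P (Suc n) w) A\<bar> \<le> K * \<rho> ^ n * N z w"
  using assms(1,2)
proof (induction n arbitrary: z w)
  case 0
  then show ?case using smoothing[OF 0 assms(3)] by (simp add: P_1 Q_def)
next
  case (Suc n)
  have "\<bar>measure (P (Suc (Suc n)) z) A - measure (P (Suc (Suc n)) w) A\<bar>
      = \<bar>\<integral>\<xi>. measure (P (Suc n) (\<Phi> z \<xi>)) A - measure (P (Suc n) (\<Phi> w \<xi>)) A \<partial>G\<bar>"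
    using Suc.prems assms(3) by (simp add: measure_P_Suc[where n = "Suc n"] P_integrable_G)
  also have "\<dots> \<le> (\<integral>\<xi>. \<bar>measure (P (Suc n) (\<Phi> z \<xi>)) A - measure (P (Suc n) (\<Phi> w \<xi>)) A\<bar> \<partial>G)"
    by (rule integral_abs_bound)
  also have "\<dots> \<le> (\<integral>\<xi>. K * \<rho> ^ Suc n * N z w \<partial>G)"
  proof (rule integral_mono)
    fix \<xi> assume \<xi>: "\<xi> \<in> space G"
    have "\<bar>measure (P (Suc n) (\<Phi> z \<xi>)) A - measure (P (Suc n) (\<Phi> w \<xi>)) A\<bar>
        \<le> K * \<rho> ^ n * N (\<Phi> z \<xi>) (\<Phi> w \<xi>)"
      using Suc.prems \<xi> by (intro Suc.IH \<Phi>_space)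
    also have "\<dots> \<le> K * \<rho> ^ n * (\<rho> * N z w)"
      using Suc.prems \<xi> K \<rho> by (intro mult_left_mono contraction) auto
    finally show "\<bar>measure (P (Suc n) (\<Phi> z \<xi>)) A - measure (P (Suc n) (\<Phi> w \<xi>)) A\<bar>
        \<le> K * \<rho> ^ Suc n * N z w" by (simp add: mult_ac)
  qed (use Suc.prems assms(3) P_integrable_G in auto)
  also have "\<dots> = K * \<rho> ^ Suc n * N z w" by (simp add: G.prob_space)
  finally show ?case .
qed

text \<open>
  One more step at the start replaces \<open>z\<^sub>0\<close> by \<open>\<Phi> z\<^sub>0 \<xi>\<close>, at a distance with finite mean, so
  consecutive laws differ by a geometric amount. The bound is telescoped: \<open>C * \<rho> ^ m - C * \<rho> ^ Suc m\<close>
  is the size of step \<open>m\<close>.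
\<close>
lemma P_Cauchy:
  assumes "A \<in> sets M"
  defines "C \<equiv> K * (\<integral>\<xi>. N z\<^sub>0 (\<Phi> z\<^sub>0 \<xi>) \<partial>G) / (1 - \<rho>)"
  shows "\<bar>measure (P (Suc (n + k)) z\<^sub>0) A - measure (P (Suc n) z\<^sub>0) A\<bar> \<le> C * \<rho> ^ n - C * \<rho> ^ (n + k)"
proof (induction k)
  case (Suc k)
  define m where "m = n + k"
  have "\<bar>measure (P (Suc (Suc m)) z\<^sub>0) A - measure (P (Suc m) z\<^sub>0) A\<bar>
      = \<bar>\<integral>\<xi>. measure (P (Suc m) (\<Phi> z\<^sub>0 \<xi>)) A - measure (P (Suc m) z\<^sub>0) A \<partial>G\<bar>"
    using assms(1) z\<^sub>0 by (subst measure_P_Suc[where n = "Suc m"]) (auto simp: P_integrable_G G.prob_space)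
  also have "\<dots> \<le> (\<integral>\<xi>. \<bar>measure (P (Suc m) (\<Phi> z\<^sub>0 \<xi>)) A - measure (P (Suc m) z\<^sub>0) A\<bar> \<partial>G)"
    by (rule integral_abs_bound)
  also have "\<dots> \<le> (\<integral>\<xi>. K * \<rho> ^ m * N z\<^sub>0 (\<Phi> z\<^sub>0 \<xi>) \<partial>G)"
  proof (rule integral_mono)
    fix \<xi> assume "\<xi> \<in> space G"
    then show "\<bar>measure (P (Suc m) (\<Phi> z\<^sub>0 \<xi>)) A - measure (P (Suc m) z\<^sub>0) A\<bar>
        \<le> K * \<rho> ^ m * N z\<^sub>0 (\<Phi> z\<^sub>0 \<xi>)"
      using P_lipschitz[OF z\<^sub>0 \<Phi>_space[OF z\<^sub>0] assms(1), of \<xi> m] by (simp add: abs_minus_commute)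
  qed (use z\<^sub>0 assms(1) P_integrable_G moment in auto)
  also have "\<dots> = K * (\<integral>\<xi>. N z\<^sub>0 (\<Phi> z\<^sub>0 \<xi>) \<partial>G) * \<rho> ^ m" by simp
  also have "K * (\<integral>\<xi>. N z\<^sub>0 (\<Phi> z\<^sub>0 \<xi>) \<partial>G) = C * (1 - \<rho>)" using \<rho> by (simp add: C_def)
  also have "C * (1 - \<rho>) * \<rho> ^ m = C * \<rho> ^ m - C * \<rho> ^ Suc m" by (simp add: algebra_simps)
  finally show ?case using Suc by (simp add: m_def)
qed simp

text \<open>
  The laws started at \<open>z\<^sub>0\<close> are Cauchy uniformly over events, so they have a limit law. It is
  invariant because \<open>w \<mapsto> Q(w, A)\<close> is a bounded function, and its integrals against
  the laws after \<open>n\<close> steps are the probabilities after \<open>n + 1\<close> steps.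
\<close>
lemma invariant_exists:
  obtains \<pi> where "invariant_law M Q \<pi>"
proof -
  define C where "C = K * (\<integral>\<xi>. N z\<^sub>0 (\<Phi> z\<^sub>0 \<xi>) \<partial>G) / (1 - \<rho>)"
  have C: "0 \<le> C" using K \<rho> N_nonneg by (simp add: C_def)
  have \<mu>: "P (Suc n) z\<^sub>0 \<in> space (prob_algebra M)" for n by (rule P_space[OF z\<^sub>0])
  have b: "(\<lambda>n. C * \<rho> ^ n) \<longlonglongrightarrow> 0"
    using tendsto_mult_left[OF LIMSEQ_power_zero[of \<rho>], of C] \<rho> by simp
  have close: "\<bar>measure (P (Suc (n + k)) z\<^sub>0) A - measure (P (Suc n) z\<^sub>0) A\<bar> \<le> C * \<rho> ^ n"
    if "A \<in> sets M" for A n k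
  proof -
    have "0 \<le> C * \<rho> ^ (n + k)" using C \<rho> by simp
    then show ?thesis using P_Cauchy[OF that, of n k] unfolding C_def by linarith
  qed
  obtain \<pi> where \<pi>: "\<pi> \<in> space (prob_algebra M)"
    and lim: "\<And>A. A \<in> sets M \<Longrightarrow> (\<lambda>n. measure (P (Suc n) z\<^sub>0) A) \<longlonglongrightarrow> measure \<pi> A"
    using setwise_Cauchy_limit[of "\<lambda>n. P (Suc n) z\<^sub>0", OF \<mu> b close] by blast
  have \<pi>': "prob_space \<pi>" "sets \<pi> = sets M" using \<pi> by (auto simp: space_prob_algebra)
  have em: "emeasure (\<nu> \<bind> Q) A = (\<integral>\<^sup>+w. ennreal (measure (Q w) A) \<partial>\<nu>)"
    if "\<nu> \<in> space (prob_algebra M)" "A \<in> sets M" for \<nu> A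
  proof -
    have "prob_space (Q w)" if "w \<in> space \<nu>" for w
      using that P_prob[of w "Suc 0"] P_1[of w] \<open>\<nu> \<in> space (prob_algebra M)\<close>
        sets_eq_imp_space_eq[of \<nu> M]
      by (simp add: space_prob_algebra)
    then show ?thesis
      using emeasure_bind_prob_algebra[OF that(1) Q_measurable that(2)]
      by (auto intro!: nn_integral_cong
          simp: finite_measure.emeasure_eq_measure prob_space.finite_measure)
  qed
  have "\<pi> \<bind> Q = \<pi>"
  proof (rule measure_eqI)
    have Q: "Q \<in> \<pi> \<rightarrow>\<^sub>M subprob_algebra M"
      using measurable_prob_algebraD[OF Q_measurable] measurable_cong_sets[OF \<pi>'(2) refl] by blast
    show S: "sets (\<pi> \<bind> Q) = sets \<pi>"
      using \<pi>' prob_space.not_empty by (subst sets_bind_measurable[OF Q]) auto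
    fix A assume "A \<in> sets (\<pi> \<bind> Q)"
    then have A: "A \<in> sets M" using S \<pi>' by simp
    have "(\<lambda>n. \<integral>\<^sup>+w. ennreal (measure (Q w) A) \<partial>P (Suc n) z\<^sub>0)
        \<longlonglongrightarrow> (\<integral>\<^sup>+w. ennreal (measure (Q w) A) \<partial>\<pi>)"
    proof (rule setwise_limit_nn_integral[of "\<lambda>n. P (Suc n) z\<^sub>0", OF \<mu> \<pi> lim])
      show "(\<lambda>w. measure (Q w) A) \<in> borel_measurable M"
        using A by (rule measurable_compose[OF Q_measurable measurable_measure_prob_algebra])
      show "measure (Q w) A \<le> 1" if "w \<in> space M" for w
        using P_prob[OF that, of "Suc 0"] P_1[OF that] by (simp add: prob_space.prob_le_1)
    qed
    moreover have "(\<integral>\<^sup>+w. ennreal (measure (Q w) A) \<partial>P (Suc n) z\<^sub>0)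
        = ennreal (measure (P (Suc (Suc n)) z\<^sub>0) A)" for n
      using em[OF \<mu> A, of n] P_prob[OF z\<^sub>0, of "Suc (Suc n)"]
      by (simp add: P_def push_Suc finite_measure.emeasure_eq_measure prob_space.finite_measure)
    ultimately have "(\<lambda>n. ennreal (measure (P (Suc (Suc n)) z\<^sub>0) A)) \<longlonglongrightarrow> emeasure (\<pi> \<bind> Q) A"
      by (simp add: em[OF \<pi> A])
    moreover have "(\<lambda>n. ennreal (measure (P (Suc (Suc n)) z\<^sub>0) A)) \<longlonglongrightarrow> ennreal (measure \<pi> A)"
      using LIMSEQ_Suc[OF lim[OF A]] by (rule tendsto_ennrealI)
    ultimately have "emeasure (\<pi> \<bind> Q) A = ennreal (measure \<pi> A)"
      by (rule LIMSEQ_unique)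
    then show "emeasure (\<pi> \<bind> Q) A = emeasure \<pi> A"
      using \<pi>' by (simp add: finite_measure.emeasure_eq_measure prob_space.finite_measure)
  qed
  then have "invariant_law M Q \<pi>" using \<pi>' by (simp add: invariant_law_def)
  then show thesis by (rule that)
qed

lemma invariant_measure_eq:
  assumes "invariant_law M Q \<pi>" "A \<in> sets M"
  shows "measure \<pi> A = (\<integral>w. measure (P n w) A \<partial>\<pi>)"
proof -
  have \<pi>: "prob_space \<pi>" "sets \<pi> = sets M" "\<pi> \<bind> Q = \<pi>"
    using assms by (auto simp: invariant_law_def)
  have "push Q n \<pi> = \<pi>" by (induction n) (simp_all add: push_Suc \<pi>)
  then have "\<pi> \<bind> P n = \<pi>" using push_eq_bind[of \<pi> n] \<pi> by simp
  then show ?thesis using measure_bind_P[OF \<pi>(1,2) assms(2), of n] by simp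
qed

text \<open>
  Under an invariant law, the probability of \<open>A\<close> is the average of the probability after
  \<open>n + 1\<close> steps; the Lipschitz bound is integrated over the starting point.
\<close>
theorem invariant_rate:
  assumes inv: "invariant_law M Q \<pi>" and z: "z \<in> space M" and A: "A \<in> sets M"
  shows "ennreal \<bar>measure (P (Suc n) z) A - measure \<pi> A\<bar>
    \<le> ennreal (K * \<rho> ^ n) * (\<integral>\<^sup>+w. ennreal (N z w) \<partial>\<pi>)"
proof -
  have \<pi>: "prob_space \<pi>" "sets \<pi> = sets M" using inv by (auto simp: invariant_law_def)
  interpret \<pi>: prob_space \<pi> by (rule \<pi>)
  have sp: "space \<pi> = space M" using \<pi>(2) by (rule sets_eq_imp_space_eq)
  note int = P_integrable[OF \<pi> A, of "Suc n"]
  have "measure (P (Suc n) z) A - measure \<pi> A = (\<integral>w. measure (P (Suc n) z) A - measure (P (Suc n) w) A \<partial>\<pi>)"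
    using int by (simp add: invariant_measure_eq[OF inv A, of "Suc n"] \<pi>.prob_space)
  then have "ennreal \<bar>measure (P (Suc n) z) A - measure \<pi> A\<bar>
      \<le> (\<integral>\<^sup>+w. ennreal \<bar>measure (P (Suc n) z) A - measure (P (Suc n) w) A\<bar> \<partial>\<pi>)"
    using integral_norm_bound_ennreal[of \<pi> "\<lambda>w. measure (P (Suc n) z) A - measure (P (Suc n) w) A"] int
    by simp
  also have "\<dots> \<le> (\<integral>\<^sup>+w. ennreal (K * \<rho> ^ n) * ennreal (N z w) \<partial>\<pi>)"
    using P_lipschitz[OF z _ A, of _ n] sp K \<rho> N_nonneg
    by (intro nn_integral_mono) (auto simp: ennreal_mult[symmetric] intro!: ennreal_leI)
  also have "\<dots> = ennreal (K * \<rho> ^ n) * (\<integral>\<^sup>+w. ennreal (N z w) \<partial>\<pi>)"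
    using N_measurable[OF z] measurable_cong_sets[OF \<pi>(2) refl, where N = borel]
    by (intro nn_integral_cmult measurable_compose[OF _ measurable_ennreal]) blast
  finally show ?thesis .
qed

text \<open>
  The chain started at \<open>z\<^sub>0\<close> converges on every event to any invariant law: the Lipschitz bound
  tends to 0 at each point, and probabilities are bounded, so bounded convergence applies whatever
  the tails of the invariant law are.
\<close>
theorem invariant_unique:
  assumes "invariant_law M Q \<pi>" "invariant_law M Q \<pi>'"
  shows "\<pi>' = \<pi>"
proof -
  have lim: "(\<lambda>n. measure (P (Suc n) z\<^sub>0) A) \<longlonglongrightarrow> measure \<nu> A"
    if inv: "invariant_law M Q \<nu>" and A: "A \<in> sets M" for \<nu> A
  proof -
    have \<nu>: "prob_space \<nu>" "sets \<nu> = sets M" using inv by (auto simp: invariant_law_def)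
    interpret \<nu>: prob_space \<nu> by (rule \<nu>)
    have sp: "space \<nu> = space M" using \<nu>(2) by (rule sets_eq_imp_space_eq)
    let ?d = "\<lambda>n w. measure (P (Suc n) z\<^sub>0) A - measure (P (Suc n) w) A"
    have int: "integrable \<nu> (?d n)" for n
      using P_integrable[OF \<nu> A, of "Suc n"] by simp
    have "(\<lambda>n. \<integral>w. ?d n w \<partial>\<nu>) \<longlonglongrightarrow> (\<integral>w. 0 \<partial>\<nu>)"
    proof (rule integral_dominated_convergence[where w = "\<lambda>_. 1"])
      show "?d n \<in> borel_measurable \<nu>" for n using int by simp
      show "AE w in \<nu>. norm (?d n w) \<le> 1" for n
      proof (rule AE_I2)
        fix w assume "w \<in> space \<nu>"
        then have "prob_space (P (Suc n) w)" "prob_space (P (Suc n) z\<^sub>0)"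
          using P_prob z\<^sub>0 sp by auto
        then have "measure (P (Suc n) w) A \<le> 1" "measure (P (Suc n) z\<^sub>0) A \<le> 1"
          by (simp_all add: prob_space.prob_le_1)
        moreover have "0 \<le> measure (P (Suc n) w) A" "0 \<le> measure (P (Suc n) z\<^sub>0) A" by simp_all
        ultimately show "norm (?d n w) \<le> 1" unfolding real_norm_def by linarith
      qed
      show "AE w in \<nu>. (\<lambda>n. ?d n w) \<longlonglongrightarrow> 0"
      proof (rule AE_I2)
        fix w assume "w \<in> space \<nu>"
        then have w: "w \<in> space M" using sp by simp
        have "(\<lambda>n. K * \<rho> ^ n * N z\<^sub>0 w) \<longlonglongrightarrow> 0"
          using tendsto_mult_left[OF LIMSEQ_power_zero[of \<rho>], of "K * N z\<^sub>0 w"] \<rho>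
          by (simp add: mult_ac)
        then show "(\<lambda>n. ?d n w) \<longlonglongrightarrow> 0"
          by (rule Lim_null_comparison[rotated]) (use P_lipschitz[OF z\<^sub>0 w A] in auto)
      qed
    qed auto
    moreover have "(\<integral>w. ?d n w \<partial>\<nu>) = measure (P (Suc n) z\<^sub>0) A - measure \<nu> A" for n
      using P_integrable[OF \<nu> A, of "Suc n"]
      by (simp add: invariant_measure_eq[OF inv A, of "Suc n"] \<nu>.prob_space)
    ultimately show ?thesis by (simp add: LIM_zero_iff)
  qed
  show ?thesis
  proof (rule measure_eqI)
    show "sets \<pi>' = sets \<pi>" using assms by (simp add: invariant_law_def)
    fix A assume "A \<in> sets \<pi>'"
    then have "A \<in> sets M" using assms by (simp add: invariant_law_def)
    then have "measure \<pi>' A = measure \<pi> A"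
      using lim assms by (metis LIMSEQ_unique)
    then show "emeasure \<pi>' A = emeasure \<pi> A"
      using assms by (simp add: invariant_law_def finite_measure.emeasure_eq_measure prob_space.finite_measure)
  qed
qed

end

section \<open>Translates of the standard Gaussian law\<close>

lemma std_normal_prob: "prob_space (density lborel std_normal_density)"
  by (rule prob_space_normal_density) simp

interpretation gaussian: product_sigma_finite "\<lambda>_ :: nat. density lborel std_normal_density"
  by (rule product_sigma_finite.intro) (rule prob_space_imp_sigma_finite[OF std_normal_prob])

text \<open>
  The weight is the density of the normal law centred at \<open>a\<close> with respect to the standard one.
\<close>
lemma gaussian_shift_real:
  assumes [measurable]: "f \<in> borel_measurable borel"
  shows "(\<integral>\<^sup>+y. f (y + a) \<partial>density lborel std_normal_density)
    = (\<integral>\<^sup>+y. f y * ennreal (exp (a * y - a\<^sup>2 / 2)) \<partial>density lborel std_normal_density)"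
proof -
  have eq: "std_normal_density (y - a) = std_normal_density y * exp (a * y - a\<^sup>2 / 2)" for y
  proof -
    have "- (y - a)\<^sup>2 / 2 = - y\<^sup>2 / 2 + (a * y - a\<^sup>2 / 2)"
      by (simp add: power2_eq_square field_simps)
    then show ?thesis by (simp add: normal_density_def exp_add[symmetric])
  qed
  have "(\<integral>\<^sup>+y. f y * ennreal (exp (a * y - a\<^sup>2 / 2)) \<partial>density lborel std_normal_density)
      = (\<integral>\<^sup>+y. ennreal (std_normal_density (y - a)) * f y \<partial>lborel)"
    by (subst nn_integral_density) (auto simp: eq ennreal_mult mult_ac intro!: nn_integral_cong)
  also have "\<dots> = (\<integral>\<^sup>+y. ennreal (std_normal_density y) * f (y + a) \<partial>lborel)"
    by (subst nn_integral_real_affine[of _ 1 a]) (auto simp: add.commute)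
  also have "\<dots> = (\<integral>\<^sup>+y. f (y + a) \<partial>density lborel std_normal_density)"
    by (subst nn_integral_density) auto
  finally show ?thesis by simp
qed

text \<open>
  The formula of Cameron and Martin in finite dimension, by induction over the coordinates.
\<close>
lemma gaussian_shift:
  fixes a :: "nat \<Rightarrow> real"
  assumes "finite I" and "f \<in> borel_measurable (\<Pi>\<^sub>M i\<in>I. density lborel std_normal_density)"
  shows "(\<integral>\<^sup>+\<xi>. f (\<lambda>i\<in>I. \<xi> i + a i) \<partial>(\<Pi>\<^sub>M i\<in>I. density lborel std_normal_density))
    = (\<integral>\<^sup>+\<xi>. f \<xi> * ennreal (\<Prod>i\<in>I. exp (a i * \<xi> i - (a i)\<^sup>2 / 2))
        \<partial>(\<Pi>\<^sub>M i\<in>I. density lborel std_normal_density))"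
  using assms
proof (induction I arbitrary: f rule: finite_induct)
  case empty
  then show ?case by (simp add: PiM_empty nn_integral_count_space_finite)
next
  case (insert k I)
  let ?S = "density lborel std_normal_density"
  let ?G = "\<lambda>J. \<Pi>\<^sub>M i\<in>J. ?S"
  have [measurable]: "f \<in> borel_measurable (?G (insert k I))" by fact
  have [measurable]: "k \<in> insert k I" by simp
  have mI [measurable]: "i \<in> insert k I" if "i \<in> I" for i using that by simp
  have shift_meas: "(\<lambda>\<xi>. \<lambda>i\<in>insert k I. \<xi> i + a i) \<in> ?G (insert k I) \<rightarrow>\<^sub>M ?G (insert k I)"
    by (intro measurable_restrict) measurable
  have weight_meas: "(\<lambda>\<xi>. \<Prod>i\<in>insert k I. exp (a i * \<xi> i - (a i)\<^sup>2 / 2)) \<in> borel_measurable (?G (insert k I))"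
    by measurable
  define g where "g x = (\<integral>\<^sup>+y. f (x(k := y)) * ennreal (exp (a k * y - (a k)\<^sup>2 / 2)) \<partial>?S)" for x
  have upd: "(\<lambda>(x, y). x(k := y)) \<in> ?G I \<Otimes>\<^sub>M ?S \<rightarrow>\<^sub>M ?G (insert k I)"
    by (rule measurable_add_dim)
  have g [measurable]: "g \<in> borel_measurable (?G I)"
  proof -
    have "(\<lambda>(x, y). f (x(k := y))) \<in> borel_measurable (?G I \<Otimes>\<^sub>M ?S)"
      using measurable_compose[OF upd insert.prems] by (simp add: split_beta)
    then show ?thesis unfolding g_def by measurable
  qed
  have f_upd: "(\<lambda>y. f (x(k := y))) \<in> borel_measurable borel" if "x \<in> space (?G I)" for x
  proof -
    have "(\<lambda>y. x(k := y)) \<in> ?S \<rightarrow>\<^sub>M ?G (insert k I)"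
      using measurable_compose[OF measurable_Pair1'[OF that] upd] by simp
    from measurable_compose[OF this insert.prems] show ?thesis by (simp add: fun_upd_def)
  qed
  have "(\<integral>\<^sup>+\<xi>. f (\<lambda>i\<in>insert k I. \<xi> i + a i) \<partial>?G (insert k I))
      = (\<integral>\<^sup>+x. (\<integral>\<^sup>+y. f (\<lambda>i\<in>insert k I. (x(k := y)) i + a i) \<partial>?S) \<partial>?G I)"
    using insert.hyps
    by (intro gaussian.product_nn_integral_insert measurable_compose[OF shift_meas insert.prems])
  also have "\<dots> = (\<integral>\<^sup>+x. g (\<lambda>i\<in>I. x i + a i) \<partial>?G I)"
  proof (intro nn_integral_cong)
    fix x assume "x \<in> space (?G I)"
    have eq: "(\<lambda>i\<in>insert k I. (x(k := y)) i + a i) = (\<lambda>i\<in>I. x i + a i)(k := y + a k)" for y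
      using insert.hyps by (auto simp: restrict_def)
    have "(\<lambda>i\<in>I. x i + a i) \<in> space (?G I)" by (simp add: space_PiM)
    from gaussian_shift_real[OF f_upd[OF this], of "a k"]
    show "(\<integral>\<^sup>+y. f (\<lambda>i\<in>insert k I. (x(k := y)) i + a i) \<partial>?S) = g (\<lambda>i\<in>I. x i + a i)"
      unfolding eq g_def .
  qed
  also have "\<dots> = (\<integral>\<^sup>+x. g x * ennreal (\<Prod>i\<in>I. exp (a i * x i - (a i)\<^sup>2 / 2)) \<partial>?G I)"
    by (rule insert.IH[OF g])
  also have "\<dots> = (\<integral>\<^sup>+x. (\<integral>\<^sup>+y. f (x(k := y))
      * ennreal (\<Prod>i\<in>insert k I. exp (a i * (x(k := y)) i - (a i)\<^sup>2 / 2)) \<partial>?S) \<partial>?G I)"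
  proof (intro nn_integral_cong)
    fix x assume x: "x \<in> space (?G I)"
    have "(\<Prod>i\<in>I. exp (a i * (x(k := y)) i - (a i)\<^sup>2 / 2)) = (\<Prod>i\<in>I. exp (a i * x i - (a i)\<^sup>2 / 2))" for y
      using insert.hyps by (intro prod.cong) auto
    then have "f (x(k := y)) * ennreal (\<Prod>i\<in>insert k I. exp (a i * (x(k := y)) i - (a i)\<^sup>2 / 2))
        = f (x(k := y)) * ennreal (exp (a k * y - (a k)\<^sup>2 / 2))
            * ennreal (\<Prod>i\<in>I. exp (a i * x i - (a i)\<^sup>2 / 2))" for y
      using insert.hyps by (simp add: ennreal_mult prod_nonneg mult_ac)
    then show "g x * ennreal (\<Prod>i\<in>I. exp (a i * x i - (a i)\<^sup>2 / 2))
      = (\<integral>\<^sup>+y. f (x(k := y)) * ennreal (\<Prod>i\<in>insert k I. exp (a i * (x(k := y)) i - (a i)\<^sup>2 / 2)) \<partial>?S)"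
      unfolding g_def using f_upd[OF x] by (simp add: nn_integral_multc)
  qed
  also have "\<dots> = (\<integral>\<^sup>+\<xi>. f \<xi> * ennreal (\<Prod>i\<in>insert k I. exp (a i * \<xi> i - (a i)\<^sup>2 / 2)) \<partial>?G (insert k I))"
    using insert.hyps weight_meas
    by (intro gaussian.product_nn_integral_insert[symmetric] borel_measurable_times_ennreal insert.prems
        measurable_compose[OF _ measurable_ennreal])
  finally show ?case .
qed

text \<open>
  The distance is governed by the Euclidean length of the shift, whatever the dimension. The
  density \<open>L 1\<close> of the shifted law satisfies \<open>(L 1)\<^sup>2 = exp (s\<^sup>2) * L 2\<close>, where \<open>s\<close> is the length
  and \<open>L 2\<close> is the density for twice the shift; hence the variance of \<open>L 1\<close> is \<open>exp (s\<^sup>2) - 1\<close>,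
  which is of order \<open>s\<^sup>2\<close> for \<open>s \<le> 1\<close>. For \<open>s > 1\<close> the bound exceeds 1.
\<close>
lemma gaussian_shift_tv:
  fixes f :: "(nat \<Rightarrow> real) \<Rightarrow> real" and a :: "nat \<Rightarrow> real"
  assumes f: "f \<in> borel_measurable (std_gaussian d)"
    and f01: "\<And>\<xi>. 0 \<le> f \<xi>" "\<And>\<xi>. f \<xi> \<le> 1"
  shows "\<bar>(\<integral>\<xi>. f (\<lambda>i\<in>{..<d}. \<xi> i + a i) \<partial>std_gaussian d) - (\<integral>\<xi>. f \<xi> \<partial>std_gaussian d)\<bar>
    \<le> 2 * L2_set a {..<d}"
proof -
  let ?G = "std_gaussian d"
  define s where "s = L2_set a {..<d}"
  have s0: "0 \<le> s" by (simp add: s_def)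
  have s2: "s\<^sup>2 = (\<Sum>i<d. (a i)\<^sup>2)" by (simp add: s_def L2_set_def sum_nonneg)
  define L where "L c \<xi> = (\<Prod>i<d. exp (c * a i * \<xi> i - (c * a i)\<^sup>2 / 2))" for c :: real and \<xi>
  have L_pos: "0 < L c \<xi>" for c \<xi> by (simp add: L_def prod_pos)
  interpret G: prob_space ?G
    unfolding std_gaussian_def by (intro prob_space_PiM std_normal_prob)
  have f_m[measurable]: "f \<in> borel_measurable ?G" by fact
  have L_m[measurable]: "L c \<in> borel_measurable ?G" for c
    unfolding L_def std_gaussian_def by measurable
  have shift_m[measurable]: "(\<lambda>\<xi>. \<lambda>i\<in>{..<d}. \<xi> i + a i) \<in> ?G \<rightarrow>\<^sub>M ?G"
    unfolding std_gaussian_def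
    by (intro measurable_restrict) measurable
  have shift: "(\<integral>\<^sup>+\<xi>. g (\<lambda>i\<in>{..<d}. \<xi> i + c * a i) \<partial>?G) = (\<integral>\<^sup>+\<xi>. g \<xi> * ennreal (L c \<xi>) \<partial>?G)"
    if "g \<in> borel_measurable ?G" for g c
    using gaussian_shift[of "{..<d}" g "\<lambda>i. c * a i"] that unfolding std_gaussian_def L_def by simp
  have L1: "(\<integral>\<^sup>+\<xi>. ennreal (L c \<xi>) \<partial>?G) = 1" for c
    using shift[of "\<lambda>_. 1" c] by (simp add: G.emeasure_space_1)
  have LL: "(L 1 \<xi>)\<^sup>2 = L 2 \<xi> * exp (s\<^sup>2)" for \<xi>
  proof -
    have "(L 1 \<xi>)\<^sup>2 = (\<Prod>i<d. exp (2 * a i * \<xi> i - (2 * a i)\<^sup>2 / 2) * exp ((a i)\<^sup>2))"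
      unfolding L_def prod_power_distrib
      by (intro prod.cong) (auto simp: exp_double[symmetric] exp_add[symmetric] power2_eq_square algebra_simps)
    then show ?thesis by (simp add: prod.distrib L_def exp_sum s2)
  qed
  have intL: "integrable ?G (L c)" for c
    using L1[of c] L_pos by (intro integrableI_nonneg) (auto simp: less_imp_le)
  have EL: "(\<integral>\<xi>. L c \<xi> \<partial>?G) = 1" for c
    using L1[of c] L_pos by (subst integral_eq_nn_integral) (auto simp: less_imp_le)
  have intLL: "integrable ?G (\<lambda>\<xi>. (L 1 \<xi>)\<^sup>2)"
    unfolding LL using intL by simp
  have ELL: "(\<integral>\<xi>. (L 1 \<xi>)\<^sup>2 \<partial>?G) = exp (s\<^sup>2)"
    unfolding LL using EL by simp
  have sq: "(L 1 \<xi> - 1)\<^sup>2 = (L 1 \<xi>)\<^sup>2 - 2 * L 1 \<xi> + 1" for \<xi>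
    by (simp add: power2_eq_square algebra_simps)
  have int_sq: "integrable ?G (\<lambda>\<xi>. (L 1 \<xi> - 1)\<^sup>2)"
    unfolding sq using intL intLL by simp
  have E_sq: "(\<integral>\<xi>. (L 1 \<xi> - 1)\<^sup>2 \<partial>?G) = exp (s\<^sup>2) - 1"
    unfolding sq using intL intLL by (simp add: EL ELL G.prob_space)
  have int_f: "integrable ?G f"
    using f01 by (intro G.integrable_const_bound[where B = 1]) auto
  have int_f_shift: "integrable ?G (\<lambda>\<xi>. f (\<lambda>i\<in>{..<d}. \<xi> i + a i))"
    using f01 by (intro G.integrable_const_bound[where B = 1]) auto
  have int_fL: "integrable ?G (\<lambda>\<xi>. f \<xi> * L 1 \<xi>)"
    using f01 L_pos intL[of 1]
    by (intro Bochner_Integration.integrable_bound[OF intL[of 1]])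
       (auto simp: abs_mult less_imp_le mult_left_le_one_le)
  have "(\<integral>\<xi>. f (\<lambda>i\<in>{..<d}. \<xi> i + a i) \<partial>?G) = (\<integral>\<xi>. f \<xi> * L 1 \<xi> \<partial>?G)"
    using shift[of "\<lambda>\<xi>. ennreal (f \<xi>)" 1] f01 L_pos
    by (subst (1 2) integral_eq_nn_integral) (auto simp: ennreal_mult less_imp_le)
  then have diff: "(\<integral>\<xi>. f (\<lambda>i\<in>{..<d}. \<xi> i + a i) \<partial>?G) - (\<integral>\<xi>. f \<xi> \<partial>?G)
      = (\<integral>\<xi>. f \<xi> * (L 1 \<xi> - 1) \<partial>?G)"
    using int_f int_fL by (simp add: algebra_simps)
  consider "s = 0" | "0 < s" "s \<le> 1" | "1 < s" using s0 by linarith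
  then show ?thesis
  proof cases
    case 1
    then have "a i = 0" if "i < d" for i
      using that unfolding s_def by (simp add: L2_set_eq_0_iff)
    then have "L 1 \<xi> = 1" for \<xi> unfolding L_def by (intro prod.neutral) auto
    then show ?thesis unfolding diff using s0 by (simp add: s_def)
  next
    case 2
    have "\<bar>\<integral>\<xi>. f \<xi> * (L 1 \<xi> - 1) \<partial>?G\<bar> \<le> (\<integral>\<xi>. \<bar>f \<xi> * (L 1 \<xi> - 1)\<bar> \<partial>?G)"
      by (rule integral_abs_bound)
    also have "\<dots> \<le> (\<integral>\<xi>. s / 2 + (L 1 \<xi> - 1)\<^sup>2 / (2 * s) \<partial>?G)"
    proof (rule integral_mono)
      fix \<xi>
      have "\<bar>f \<xi> * (L 1 \<xi> - 1)\<bar> \<le> \<bar>L 1 \<xi> - 1\<bar>"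
        using f01[of \<xi>] by (simp add: abs_mult mult_left_le_one_le)
      \<comment> \<open>The arithmetic-geometric mean inequality, balanced at the expected size \<open>s\<close> of \<open>L 1 - 1\<close>.\<close>
      also have "\<dots> \<le> s / 2 + (L 1 \<xi> - 1)\<^sup>2 / (2 * s)"
      proof -
        have "0 \<le> (s - \<bar>L 1 \<xi> - 1\<bar>)\<^sup>2" by simp
        then have "2 * s * \<bar>L 1 \<xi> - 1\<bar> \<le> s\<^sup>2 + (L 1 \<xi> - 1)\<^sup>2"
          by (simp add: power2_diff)
        then show ?thesis using 2 by (simp add: field_simps power2_eq_square)
      qed
      finally show "\<bar>f \<xi> * (L 1 \<xi> - 1)\<bar> \<le> s / 2 + (L 1 \<xi> - 1)\<^sup>2 / (2 * s)" .
    next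
      show "integrable ?G (\<lambda>\<xi>. \<bar>f \<xi> * (L 1 \<xi> - 1)\<bar>)"
        using int_f int_fL by (auto simp: right_diff_distrib intro!: integrable_abs)
      show "integrable ?G (\<lambda>\<xi>. s / 2 + (L 1 \<xi> - 1)\<^sup>2 / (2 * s))"
        using int_sq by simp
    qed
    also have "\<dots> = s / 2 + (exp (s\<^sup>2) - 1) / (2 * s)"
      using int_sq by (simp add: E_sq G.prob_space)
    also have "\<dots> \<le> s / 2 + (2 * s\<^sup>2) / (2 * s)"
    proof -
      have "s\<^sup>2 \<le> 1" using 2 by (simp add: power_le_one)
      then have "exp (s\<^sup>2) \<le> 1 + s\<^sup>2 + (s\<^sup>2)\<^sup>2" by (intro exp_bound) auto
      also have "(s\<^sup>2)\<^sup>2 \<le> s\<^sup>2" using \<open>s\<^sup>2 \<le> 1\<close> by (simp add: power2_eq_square mult_left_le)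
      finally have "exp (s\<^sup>2) - 1 \<le> 2 * s\<^sup>2" by simp
      then show ?thesis using 2 by (intro add_left_mono divide_right_mono) auto
    qed
    also have "\<dots> \<le> 2 * s" using 2 by (simp add: power2_eq_square)
    finally show ?thesis unfolding diff s_def .
  next
    case 3
    have "(\<integral>\<xi>. f \<xi> \<partial>?G) \<le> 1" "(\<integral>\<xi>. f (\<lambda>i\<in>{..<d}. \<xi> i + a i) \<partial>?G) \<le> 1"
      using int_f int_f_shift f01 by (auto intro!: G.integral_le_const)
    moreover have "0 \<le> (\<integral>\<xi>. f \<xi> \<partial>?G)" "0 \<le> (\<integral>\<xi>. f (\<lambda>i\<in>{..<d}. \<xi> i + a i) \<partial>?G)"
      using f01 by (auto intro!: integral_nonneg_AE)
    ultimately show ?thesis using 3 unfolding s_def by linarith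
  qed
qed

lemma gaussian_coordinate_integrable:
  assumes "i < d"
  shows "integrable (std_gaussian d) (\<lambda>\<xi>. \<bar>\<xi> i\<bar>)"
proof -
  let ?S = "density lborel std_normal_density"
  have "integrable ?S (\<lambda>y. \<bar>y\<bar>)"
    using integrable_std_normal_moment_abs[of 1]
    by (subst integrable_density) auto
  moreover have "distr (std_gaussian d) ?S (\<lambda>\<xi>. \<xi> i) = ?S"
    unfolding std_gaussian_def using assms
    by (intro distr_PiM_component std_normal_prob) auto
  ultimately have "integrable (distr (std_gaussian d) ?S (\<lambda>\<xi>. \<xi> i)) (\<lambda>y. \<bar>y\<bar>)" by simp
  then show ?thesis
    unfolding std_gaussian_def using assms by (subst (asm) integrable_distr_eq) auto
qed


lemma prob_space_std_gaussian: "prob_space (std_gaussian d)"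
  unfolding std_gaussian_def by (intro prob_space_PiM std_normal_prob)

text \<open>
  The two halves of the noise are shifted one after the other, each with the other one frozen.
\<close>
lemma gaussian_pair_shift_tv:
  fixes F :: "(nat \<Rightarrow> real) \<times> (nat \<Rightarrow> real) \<Rightarrow> real"
  assumes F[measurable]: "F \<in> borel_measurable (std_gaussian d \<Otimes>\<^sub>M std_gaussian d)"
    and F01: "\<And>\<xi>. 0 \<le> F \<xi>" "\<And>\<xi>. F \<xi> \<le> 1"
  shows "\<bar>(\<integral>\<xi>. F (\<lambda>i\<in>{..<d}. fst \<xi> i + a i, \<lambda>i\<in>{..<d}. snd \<xi> i + b i)
        \<partial>(std_gaussian d \<Otimes>\<^sub>M std_gaussian d))
      - (\<integral>\<xi>. F \<xi> \<partial>(std_gaussian d \<Otimes>\<^sub>M std_gaussian d))\<bar>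
    \<le> 2 * (L2_set a {..<d} + L2_set b {..<d})"
proof -
  let ?G = "std_gaussian d"
  let ?sh = "\<lambda>a \<xi>. \<lambda>i\<in>{..<d}. \<xi> i + a i :: real"
  interpret G: prob_space ?G by (rule prob_space_std_gaussian)
  interpret GG: pair_prob_space ?G ?G ..
  have sh[measurable]: "?sh c \<in> ?G \<rightarrow>\<^sub>M ?G" for c
    unfolding std_gaussian_def by (intro measurable_restrict) measurable
  have bounded_integrable: "integrable M f"
    if "prob_space M" "f \<in> borel_measurable M" "\<And>x. 0 \<le> f x" "\<And>x. f x \<le> 1"
    for M :: "'z measure" and f :: "'z \<Rightarrow> real"
    using that by (intro finite_measure.integrable_const_bound[where B = 1] prob_space.finite_measure) auto
  have integral01: "0 \<le> (\<integral>x. f x \<partial>M) \<and> (\<integral>x. f x \<partial>M) \<le> 1"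
    if "prob_space M" "\<And>x. 0 \<le> f x" "\<And>x. f x \<le> 1" for M :: "'z measure" and f :: "'z \<Rightarrow> real"
  proof (cases "integrable M f")
    case True
    then show ?thesis using that by (auto intro!: prob_space.integral_le_const)
  qed (simp add: not_integrable_integral_eq)
  define H where "H \<xi> = (\<integral>\<eta>. F (\<xi>, \<eta>) \<partial>?G)" for \<xi>
  define H' where "H' \<xi> = (\<integral>\<eta>. F (\<xi>, ?sh b \<eta>) \<partial>?G)" for \<xi>
  have H_m[measurable]: "H \<in> borel_measurable ?G" and H'_m[measurable]: "H' \<in> borel_measurable ?G"
    unfolding H_def H'_def by measurable
  have H01: "0 \<le> H \<xi>" "H \<xi> \<le> 1" and H'01: "0 \<le> H' \<xi>" "H' \<xi> \<le> 1" for \<xi>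
    unfolding H_def H'_def by (simp_all add: integral01 prob_space_std_gaussian F01)
  have inner: "(\<integral>\<xi>. F \<xi> \<partial>(?G \<Otimes>\<^sub>M ?G)) = (\<integral>\<xi>. H \<xi> \<partial>?G)"
    unfolding H_def using F F01
    by (intro GG.integral_fst'[symmetric] bounded_integrable GG.prob_space_axioms)
  have shifted: "(\<integral>\<xi>. F (?sh a (fst \<xi>), ?sh b (snd \<xi>)) \<partial>(?G \<Otimes>\<^sub>M ?G)) = (\<integral>\<xi>. H' (?sh a \<xi>) \<partial>?G)"
    unfolding H'_def using F01
    by (subst GG.integral_fst'[symmetric]) (auto intro!: bounded_integrable GG.prob_space_axioms)
  have snd_shift: "\<bar>(\<integral>\<xi>. H' (?sh a \<xi>) \<partial>?G) - (\<integral>\<xi>. H (?sh a \<xi>) \<partial>?G)\<bar> \<le> 2 * L2_set b {..<d}"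
  proof -
    have int: "integrable ?G (\<lambda>\<xi>. H' (?sh a \<xi>))" "integrable ?G (\<lambda>\<xi>. H (?sh a \<xi>))"
      using H01 H'01 by (auto intro!: bounded_integrable prob_space_std_gaussian)
    have "\<bar>\<integral>\<xi>. H' (?sh a \<xi>) - H (?sh a \<xi>) \<partial>?G\<bar> \<le> (\<integral>\<xi>. \<bar>H' (?sh a \<xi>) - H (?sh a \<xi>)\<bar> \<partial>?G)"
      by (rule integral_abs_bound)
    also have "\<dots> \<le> (\<integral>\<xi>. 2 * L2_set b {..<d} \<partial>?G)"
    proof (rule integral_mono)
      fix \<xi> assume "\<xi> \<in> space ?G"
      then have "?sh a \<xi> \<in> space ?G" by (rule measurable_space[OF sh])
      then have "(\<lambda>\<eta>. F (?sh a \<xi>, \<eta>)) \<in> borel_measurable ?G"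
        by measurable
      then show "\<bar>H' (?sh a \<xi>) - H (?sh a \<xi>)\<bar> \<le> 2 * L2_set b {..<d}"
        unfolding H_def H'_def using F01 by (rule gaussian_shift_tv)
    qed (use int in auto)
    finally show ?thesis using int by (simp add: G.prob_space)
  qed
  have fst_shift: "\<bar>(\<integral>\<xi>. H (?sh a \<xi>) \<partial>?G) - (\<integral>\<xi>. H \<xi> \<partial>?G)\<bar> \<le> 2 * L2_set a {..<d}"
    using H_m H01 by (rule gaussian_shift_tv)
  have "\<bar>p - q\<bar> \<le> 2 * v \<Longrightarrow> \<bar>q - s\<bar> \<le> 2 * u \<Longrightarrow> \<bar>p - s\<bar> \<le> 2 * (u + v)" for p q s u v :: real
    by (auto simp: abs_le_iff)
  from this[OF snd_shift fst_shift] show ?thesis unfolding inner shifted .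
qed

section \<open>Strongly convex potentials with bounded Hessian\<close>

definition line :: "nat \<Rightarrow> (nat \<Rightarrow> real) \<Rightarrow> (nat \<Rightarrow> real) \<Rightarrow> real \<Rightarrow> (nat \<Rightarrow> real)" where
  "line d x w s = (\<lambda>i\<in>{..<d}. x i + s * w i)"

lemma restrict_in_Rd [simp]: "(\<lambda>i\<in>{..<d}. g i) \<in> Rd d"
  by (simp add: Rd_def)

lemma line_in_Rd [simp]: "line d x w s \<in> Rd d"
  by (simp add: line_def)

text \<open>
  Existence and continuity of the partial derivatives give the chain rule along a line. The
  direction is opened one coordinate at a time: in the step, the first \<open>k\<close> coordinates and the
  coordinate \<open>k\<close> are moved by separate parameters \<open>s\<close> and \<open>t\<close>, the map of \<open>(s, t)\<close> is
  differentiable because its second partial derivative is continuous, and then \<open>t = s\<close>.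
\<close>
lemma derivative_along_coordinate_path:
  assumes part: "has_partials d f" and cont: "\<And>i. i < d \<Longrightarrow> continuous_on (Rd d) (partial i f)"
    and x: "x \<in> Rd d" and "k \<le> d"
  shows "((\<lambda>s. f (\<lambda>i\<in>{..<d}. x i + (if i < k then s * w i else 0)))
    has_derivative (\<lambda>t. t * (\<Sum>i<k. partial i f x * w i))) (at 0)"
  using \<open>k \<le> d\<close>
proof (induction k)
  case 0
  then show ?case by simp
next
  case (Suc k)
  define p where "p s t = (\<lambda>i\<in>{..<d}. x i + (if i < k then s * w i else if i = k then t * w i else 0))"
    for s t :: real
  have p_Rd: "p s t \<in> Rd d" for s t by (simp add: p_def)
  have p0: "p 0 0 = x"
    using x by (auto simp: p_def Rd_def PiE_def extensional_def)
  define D :: "real \<Rightarrow> real \<Rightarrow> real \<Rightarrow>\<^sub>L real"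
    where "D s t = (partial k f (p s t) * w k) *\<^sub>R id_blinfun" for s t
  have "((\<lambda>(s, t). f (p s t)) has_derivative
      (\<lambda>(s, t). s * (\<Sum>i<k. partial i f x * w i) + D 0 0 t)) (at (0, 0) within UNIV \<times> UNIV)"
  proof (rule has_derivative_partialsI[where f = "\<lambda>s t. f (p s t)" and fy = D])
    have eq: "(\<lambda>s. f (p s 0)) = (\<lambda>s. f (\<lambda>i\<in>{..<d}. x i + (if i < k then s * w i else 0)))"
      by (intro ext arg_cong[where f = f]) (simp add: p_def cong: if_cong)
    show "((\<lambda>s. f (p s 0)) has_derivative (\<lambda>s. s * (\<Sum>i<k. partial i f x * w i))) (at 0)"
      unfolding eq by (rule Suc.IH) (use Suc.prems in simp)
  next
    fix s t :: real
    have upd: "p s t' = (p s t)(k := x k + t' * w k)" for t'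
      using Suc.prems by (auto simp: p_def)
    have pk: "p s t k = x k + t * w k" using Suc.prems by (simp add: p_def)
    have "((\<lambda>u. f ((p s t)(k := u))) has_field_derivative partial k f (p s t)) (at (x k + t * w k))"
      using part p_Rd Suc.prems pk unfolding has_partials_def partial_def
      by (metis DERIV_deriv_iff_field_differentiable Suc_le_lessD)
    moreover have "((\<lambda>t'. x k + t' * w k) has_field_derivative w k) (at t)"
      by (auto intro!: derivative_eq_intros)
    ultimately have "((\<lambda>t'. f ((p s t)(k := x k + t' * w k))) has_field_derivative partial k f (p s t) * w k) (at t)"
      by (rule DERIV_chain2)
    moreover have "(\<lambda>t'. f ((p s t)(k := x k + t' * w k))) = (\<lambda>t'. f (p s t'))"
      by (rule ext) (simp only: upd[symmetric])
    ultimately have "((\<lambda>t'. f (p s t')) has_field_derivative partial k f (p s t) * w k) (at t)"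
      by simp
    moreover have "blinfun_apply (D s t) = (*) (partial k f (p s t) * w k)"
      by (simp add: D_def fun_eq_iff blinfun.scaleR_left)
    ultimately show "((\<lambda>t'. f (p s t')) has_derivative blinfun_apply (D s t)) (at t)"
      by (simp add: has_field_derivative_def)
  next
    have cp: "continuous_on UNIV (\<lambda>(s, t). p s t)"
    proof (rule continuous_on_coordinatewise_then_product)
      fix i
      show "continuous_on UNIV (\<lambda>z. (case z of (s, t) \<Rightarrow> p s t) i)"
        by (cases "i < d"; cases "i < k"; cases "i = k")
           (auto simp: p_def split_beta intro!: continuous_intros)
    qed
    have "continuous_on UNIV (\<lambda>z. partial k f (case z of (s, t) \<Rightarrow> p s t))"
      using Suc.prems by (intro continuous_on_compose2[OF cont cp]) (auto simp: p_Rd)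
    then have "continuous_on UNIV (\<lambda>(s, t). D s t)"
      unfolding D_def split_beta by (intro continuous_intros)
    then show "continuous (at (0, 0) within UNIV \<times> UNIV) (\<lambda>(s, t). D s t)"
      by (simp add: continuous_on_eq_continuous_within)
  qed auto
  then have F: "((\<lambda>(s, t). f (p s t)) has_derivative
      (\<lambda>(s, t). s * (\<Sum>i<k. partial i f x * w i) + D 0 0 t)) (at ((\<lambda>s. (s, s)) 0))"
    by simp
  have "((\<lambda>s::real. (s, s)) has_derivative (\<lambda>s. (s, s))) (at 0)"
    by (intro derivative_intros)
  from diff_chain_at[OF this F]
  have "((\<lambda>s. f (p s s)) has_derivative (\<lambda>t. t * (\<Sum>i<Suc k. partial i f x * w i))) (at 0)"
    by (simp add: o_def D_def p0 blinfun.scaleR_left algebra_simps)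
  moreover have "p s s = (\<lambda>i\<in>{..<d}. x i + (if i < Suc k then s * w i else 0))" for s
    by (auto simp: p_def less_Suc_eq)
  ultimately show ?case by (simp only:)
qed

lemma derivative_along_line:
  assumes part: "has_partials d f" and cont: "\<And>i. i < d \<Longrightarrow> continuous_on (Rd d) (partial i f)"
  shows "((\<lambda>s. f (line d x w s)) has_real_derivative
    (\<Sum>i<d. partial i f (line d x w s) * w i)) (at s)"
proof -
  let ?y = "line d x w s"
  have "line d x w (t + s) = (\<lambda>i\<in>{..<d}. ?y i + (if i < d then t * w i else 0))" for t
    by (auto simp: line_def algebra_simps)
  then have "((\<lambda>t. f (line d x w (t + s))) has_derivative
      (\<lambda>t. t * (\<Sum>i<d. partial i f ?y * w i))) (at 0)"
    using derivative_along_coordinate_path[OF part cont line_in_Rd order_refl, of x w s] by simp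
  then have "((\<lambda>t. f (line d x w (t + s))) has_real_derivative (\<Sum>i<d. partial i f ?y * w i)) (at 0)"
    by (simp add: has_field_derivative_def mult_commute_abs)
  then show ?thesis using DERIV_shift[of "\<lambda>s. f (line d x w s)" _ 0 s] by simp
qed

lemma C_infinity_D:
  assumes "C_infinity d f"
  shows "continuous_on (Rd d) f" "has_partials d f" "i < d \<Longrightarrow> C_infinity d (partial i f)"
proof -
  have *: "C_k d (Suc k) f" for k using assms[unfolded C_infinity_def] by (rule spec)
  show "continuous_on (Rd d) f" "has_partials d f" using *[of 0] by simp_all
  show "C_infinity d (partial i f)" if "i < d"
    unfolding C_infinity_def using * that by (simp only: C_k.simps) blast
qed

lemma scaled_id_form:
  "(\<Sum>i<d. \<Sum>j<d. w i * scaled_id c i j * w j) = c * (\<Sum>i<d. (w i)\<^sup>2)"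
proof -
  have "(\<Sum>j<d. w i * scaled_id c i j * w j) = c * (w i)\<^sup>2" if "i < d" for i
  proof -
    have "(\<Sum>j<d. w i * scaled_id c i j * w j) = (\<Sum>j<d. if j = i then c * (w i)\<^sup>2 else 0)"
      by (intro sum.cong) (auto simp: scaled_id_def power2_eq_square)
    then show ?thesis using that by simp
  qed
  then show ?thesis by (simp add: sum_distrib_left)
qed

text \<open>
  Taylor's formula along the segment from \<open>y\<close> to \<open>y + w\<close>. The second derivative is the quadratic
  form of the Hessian at an intermediate point, which the two matrix bounds control.
\<close>
lemma second_order_bounds:
  assumes U: "U \<in> U_class \<kappa> d" and y: "y \<in> Rd d" and w: "w \<in> Rd d"
  shows "U (line d y w 1) \<ge> U y + (\<Sum>i<d. gradient U y i * w i) + (\<Sum>i<d. (w i)\<^sup>2) / 2"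
    and "U (line d y w 1) \<le> U y + (\<Sum>i<d. gradient U y i * w i) + \<kappa> * (\<Sum>i<d. (w i)\<^sup>2) / 2"
proof -
  have C: "C_infinity d U" using U by (simp add: U_class_def)
  note C1 = C_infinity_D(3)[OF C]
  have l0: "line d y w 0 = y" using y by (auto simp: line_def Rd_def PiE_def extensional_def)
  define D where "D m s = (if m = 0 then U (line d y w s)
      else if m = 1 then \<Sum>i<d. partial i U (line d y w s) * w i
      else \<Sum>i<d. (\<Sum>j<d. partial j (partial i U) (line d y w s) * w j) * w i)" for m :: nat and s
  have D1: "(D 0 has_real_derivative D 1 s) (at s)" for s
    unfolding D_def using derivative_along_line[OF C_infinity_D(2)[OF C] C_infinity_D(1)[OF C1]]
    by simp
  have D2: "(D 1 has_real_derivative D 2 s) (at s)" for s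
  proof -
    have "((\<lambda>s. \<Sum>i<d. partial i U (line d y w s) * w i) has_real_derivative
      (\<Sum>i<d. (\<Sum>j<d. partial j (partial i U) (line d y w s) * w j) * w i)) (at s)"
      by (intro DERIV_sum DERIV_cmult_right derivative_along_line C_infinity_D(2)[OF C1]
          C_infinity_D(1)[OF C_infinity_D(3)[OF C1]]) auto
    then show ?thesis by (simp add: D_def[abs_def])
  qed
  have "\<exists>t. 0 < t \<and> t < 1 \<and> D 0 1 = (\<Sum>m<2. D m 0 / fact m * 1 ^ m) + D 2 t / fact 2 * 1 ^ 2"
  proof (rule Maclaurin)
    show "\<forall>m t. m < 2 \<and> 0 \<le> t \<and> t \<le> 1 \<longrightarrow> (D m has_real_derivative D (Suc m) t) (at t)"
    proof (intro allI impI)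
      fix m t assume "m < (2::nat) \<and> 0 \<le> t \<and> t \<le> (1::real)"
      then have "m = 0 \<or> m = 1" by auto
      then show "(D m has_real_derivative D (Suc m) t) (at t)"
        using D1 D2 by (auto simp: numeral_2_eq_2)
    qed
  qed auto
  then obtain t where t: "D 0 1 = D 0 0 + D 1 0 + D 2 t / 2"
    by (auto simp: numeral_2_eq_2)
  have D2_eq: "D 2 t = (\<Sum>i<d. \<Sum>j<d. w i * hessian U (line d y w t) i j * w j)"
  proof -
    have "D 2 t = (\<Sum>i<d. \<Sum>j<d. w j * hessian U (line d y w t) j i * w i)"
      by (simp add: D_def hessian_def sum_distrib_left sum_distrib_right mult_ac)
    also have "\<dots> = (\<Sum>j<d. \<Sum>i<d. w j * hessian U (line d y w t) j i * w i)"
      by (rule sum.swap)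
    finally show ?thesis .
  qed
  have split: "(\<Sum>i<d. \<Sum>j<d. w i * (A i j - B i j) * w j)
      = (\<Sum>i<d. \<Sum>j<d. w i * A i j * w j) - (\<Sum>i<d. \<Sum>j<d. w i * B i j * w j)" for A B
    by (simp add: sum_subtractf[symmetric] algebra_simps)
  have "loewner_le d (scaled_id 1) (hessian U (line d y w t))"
    "loewner_le d (hessian U (line d y w t)) (scaled_id \<kappa>)"
    using U by (simp_all add: U_class_def)
  then have "(\<Sum>i<d. (w i)\<^sup>2) \<le> D 2 t" "D 2 t \<le> \<kappa> * (\<Sum>i<d. (w i)\<^sup>2)"
    unfolding loewner_le_def D2_eq using w
    by (auto simp: split scaled_id_form dest!: bspec[of _ _ w])
  moreover have "D 0 1 = U (line d y w 1)" "D 0 0 = U y" "D 1 0 = (\<Sum>i<d. gradient U y i * w i)"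
    by (simp_all add: D_def l0 gradient_def)
  ultimately show "U (line d y w 1) \<ge> U y + (\<Sum>i<d. gradient U y i * w i) + (\<Sum>i<d. (w i)\<^sup>2) / 2"
    and "U (line d y w 1) \<le> U y + (\<Sum>i<d. gradient U y i * w i) + \<kappa> * (\<Sum>i<d. (w i)\<^sup>2) / 2"
    using t by simp_all
qed

text \<open>
  The argument of Baillon and Haddad for the convex function \<open>U - \<bar>x\<bar>\<^sup>2 / 2\<close>, whose gradient
  is \<open>(\<kappa> - 1)\<close>-Lipschitz; \<open>q\<close> is the increment of that gradient. The lower second-order bound
  at \<open>y\<close> and the upper one at \<open>x\<close> are compared at the common point \<open>x - q / (\<kappa> - 1)\<close>, which
  minimises the resulting quadratic.
\<close>
lemma gradient_gap:
  assumes U: "U \<in> U_class \<kappa> d" and \<kappa>: "1 < \<kappa>" and x: "x \<in> Rd d" and y: "y \<in> Rd d"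
  defines "q \<equiv> \<lambda>i. (gradient U x i - x i) - (gradient U y i - y i)"
  shows "U x - U y - (\<Sum>i<d. gradient U y i * (x i - y i))
    \<ge> (\<Sum>i<d. (x i - y i)\<^sup>2) / 2 + (\<Sum>i<d. (q i)\<^sup>2) / (2 * (\<kappa> - 1))"
proof -
  define c where "c = 1 / (\<kappa> - 1)"
  have c: "(\<kappa> - 1) * c = 1" using \<kappa> by (simp add: c_def)
  define u where "u = (\<lambda>i\<in>{..<d}. x i - y i - c * q i)"
  define v where "v = (\<lambda>i\<in>{..<d}. - c * q i)"
  have "line d y u 1 = line d x v 1" by (auto simp: line_def u_def v_def)
  then have "U y + (\<Sum>i<d. gradient U y i * u i) + (\<Sum>i<d. (u i)\<^sup>2) / 2
      \<le> U x + (\<Sum>i<d. gradient U x i * v i) + \<kappa> * (\<Sum>i<d. (v i)\<^sup>2) / 2"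
    using second_order_bounds(1)[OF U y, of u] second_order_bounds(2)[OF U x, of v]
    by (simp add: u_def v_def)
  then have 1: "(\<Sum>i<d. gradient U y i * u i + (u i)\<^sup>2 / 2 - gradient U x i * v i - \<kappa> * (v i)\<^sup>2 / 2)
      \<le> U x - U y"
    by (simp add: sum.distrib sum_subtractf sum_divide_distrib sum_distrib_left)
  have "(\<Sum>i<d. gradient U y i * u i + (u i)\<^sup>2 / 2 - gradient U x i * v i - \<kappa> * (v i)\<^sup>2 / 2)
      = (\<Sum>i<d. gradient U y i * (x i - y i) + (x i - y i)\<^sup>2 / 2 + c / 2 * (q i)\<^sup>2)"
  proof (intro sum.cong refl)
    fix i assume "i \<in> {..<d}"
    then have uv: "u i = x i - y i - c * q i" "v i = - c * q i" by (simp_all add: u_def v_def)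
    have gx: "gradient U x i = gradient U y i + q i + (x i - y i)" by (simp add: q_def)
    have "gradient U y i * u i + (u i)\<^sup>2 / 2 - gradient U x i * v i - \<kappa> * (v i)\<^sup>2 / 2
        = gradient U y i * (x i - y i) + (x i - y i)\<^sup>2 / 2 + c * (q i)\<^sup>2 - ((\<kappa> - 1) * c) * c * (q i)\<^sup>2 / 2"
      unfolding gx uv by (simp add: power2_eq_square field_simps)
    then show "gradient U y i * u i + (u i)\<^sup>2 / 2 - gradient U x i * v i - \<kappa> * (v i)\<^sup>2 / 2
        = gradient U y i * (x i - y i) + (x i - y i)\<^sup>2 / 2 + c / 2 * (q i)\<^sup>2"
      unfolding c by (simp add: field_simps)
  qed
  also have "\<dots> = (\<Sum>i<d. gradient U y i * (x i - y i)) + (\<Sum>i<d. (x i - y i)\<^sup>2) / 2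
      + c / 2 * (\<Sum>i<d. (q i)\<^sup>2)"
    by (simp add: sum.distrib sum_divide_distrib sum_distrib_left)
  finally show ?thesis using 1 by (simp add: c_def algebra_simps)
qed

text \<open>
  Adding the previous inequality for \<open>(x, y)\<close> and for \<open>(y, x)\<close> eliminates the values of \<open>U\<close>.
\<close>
lemma gradient_cocoercive:
  assumes U: "U \<in> U_class \<kappa> d" and \<kappa>: "1 < \<kappa>" and x: "x \<in> Rd d" and y: "y \<in> Rd d"
  defines "q \<equiv> \<lambda>i. (gradient U x i - x i) - (gradient U y i - y i)"
  shows "(\<Sum>i<d. (q i)\<^sup>2) \<le> (\<kappa> - 1) * (\<Sum>i<d. q i * (x i - y i))"
proof -
  have "(\<Sum>i<d. (x i - y i)\<^sup>2) + (\<Sum>i<d. (q i)\<^sup>2) / (\<kappa> - 1)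
      \<le> (\<Sum>i<d. gradient U x i * (x i - y i)) - (\<Sum>i<d. gradient U y i * (x i - y i))"
  proof -
    have q: "(\<Sum>i<d. ((gradient U x i - x i) - (gradient U y i - y i))\<^sup>2) = (\<Sum>i<d. (q i)\<^sup>2)"
      "(\<Sum>i<d. ((gradient U y i - y i) - (gradient U x i - x i))\<^sup>2) = (\<Sum>i<d. (q i)\<^sup>2)"
      by (auto simp: q_def power2_commute intro!: sum.cong)
    have half: "(\<Sum>i<d. (q i)\<^sup>2) / (2 * (\<kappa> - 1)) = (\<Sum>i<d. (q i)\<^sup>2) / (\<kappa> - 1) / 2" by simp
    have "(\<Sum>i<d. (y i - x i)\<^sup>2) = (\<Sum>i<d. (x i - y i)\<^sup>2)"
      by (simp add: power2_commute)
    moreover have "(\<Sum>i<d. gradient U x i * (y i - x i)) = - (\<Sum>i<d. gradient U x i * (x i - y i))"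
      by (simp add: sum_negf[symmetric] algebra_simps)
    ultimately show ?thesis
      using gradient_gap[OF U \<kappa> x y, unfolded q half] gradient_gap[OF U \<kappa> y x, unfolded q half]
      by linarith
  qed
  also have "\<dots> = (\<Sum>i<d. q i * (x i - y i)) + (\<Sum>i<d. (x i - y i)\<^sup>2)"
    unfolding q_def by (simp add: sum_subtractf[symmetric] sum.distrib[symmetric] power2_eq_square algebra_simps)
  finally show ?thesis using \<kappa> by (simp add: field_simps)
qed

text \<open>
  With \<open>\<delta> = x - y\<close>, a gradient step sends the difference to \<open>(1 - t) \<delta> - t q\<close>, and cocoercivity
  makes the cross term outweigh \<open>t\<^sup>2 \<bar>q\<bar>\<^sup>2\<close> as long as \<open>t * (\<kappa> - 1) \<le> 2 * (1 - t)\<close>.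
\<close>
lemma gradient_step_contracts:
  assumes U: "U \<in> U_class \<kappa> d" and \<kappa>: "1 < \<kappa>" and x: "x \<in> Rd d" and y: "y \<in> Rd d"
    and t: "0 \<le> t" "t * \<kappa> \<le> 1"
  shows "L2_set (\<lambda>i. x i - y i - t * (gradient U x i - gradient U y i)) {..<d}
    \<le> (1 - t) * L2_set (\<lambda>i. x i - y i) {..<d}"
proof -
  define q where "q = (\<lambda>i. (gradient U x i - x i) - (gradient U y i - y i))"
  define B where "B = (\<Sum>i<d. q i * (x i - y i))"
  have co: "(\<Sum>i<d. (q i)\<^sup>2) \<le> (\<kappa> - 1) * B"
    using gradient_cocoercive[OF U \<kappa> x y] by (simp add: q_def B_def)
  have "0 \<le> (\<Sum>i<d. (q i)\<^sup>2)" by (simp add: sum_nonneg)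
  then have "0 \<le> (\<kappa> - 1) * B" using co by simp
  then have B: "0 \<le> B" using \<kappa> by (simp add: zero_le_mult_iff)
  have t1: "t \<le> 1"
    using t \<kappa> by (smt (verit) mult_le_cancel_left1)
  have "(\<Sum>i<d. (x i - y i - t * (gradient U x i - gradient U y i))\<^sup>2)
      = (\<Sum>i<d. (1 - t)\<^sup>2 * (x i - y i)\<^sup>2 - 2 * t * (1 - t) * (q i * (x i - y i)) + t\<^sup>2 * (q i)\<^sup>2)"
    by (intro sum.cong) (auto simp: q_def power2_eq_square algebra_simps)
  also have "\<dots> = (1 - t)\<^sup>2 * (\<Sum>i<d. (x i - y i)\<^sup>2) - 2 * t * (1 - t) * B + t\<^sup>2 * (\<Sum>i<d. (q i)\<^sup>2)"
    by (simp add: B_def sum.distrib sum_subtractf sum_distrib_left)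
  also have "\<dots> \<le> (1 - t)\<^sup>2 * (\<Sum>i<d. (x i - y i)\<^sup>2) - 2 * t * (1 - t) * B + t\<^sup>2 * ((\<kappa> - 1) * B)"
    using co by (intro add_left_mono mult_left_mono) auto
  also have "\<dots> = (1 - t)\<^sup>2 * (\<Sum>i<d. (x i - y i)\<^sup>2) - (t * B) * (2 * (1 - t) - t * (\<kappa> - 1))"
    by (simp add: power2_eq_square algebra_simps)
  also have "\<dots> \<le> (1 - t)\<^sup>2 * (\<Sum>i<d. (x i - y i)\<^sup>2)"
  proof -
    have "0 \<le> 2 * (1 - t) - t * (\<kappa> - 1)" using t t1 by (simp add: algebra_simps)
    then show ?thesis using t B by simp
  qed
  finally have "sqrt (\<Sum>i<d. (x i - y i - t * (gradient U x i - gradient U y i))\<^sup>2)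
      \<le> sqrt ((1 - t)\<^sup>2 * (\<Sum>i<d. (x i - y i)\<^sup>2))"
    by (rule real_sqrt_le_mono)
  then show ?thesis using t1 by (simp add: L2_set_def real_sqrt_mult)
qed

lemma gradient_lipschitz:
  assumes U: "U \<in> U_class \<kappa> d" and \<kappa>: "1 < \<kappa>" and x: "x \<in> Rd d" and y: "y \<in> Rd d"
  shows "L2_set (\<lambda>i. gradient U x i - gradient U y i) {..<d} \<le> \<kappa> * L2_set (\<lambda>i. x i - y i) {..<d}"
proof -
  define q where "q = (\<lambda>i. (gradient U x i - x i) - (gradient U y i - y i))"
  define B where "B = (\<Sum>i<d. q i * (x i - y i))"
  define X where "X = (\<Sum>i<d. (x i - y i)\<^sup>2)"
  have co: "(\<Sum>i<d. (q i)\<^sup>2) \<le> (\<kappa> - 1) * B"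
    using gradient_cocoercive[OF U \<kappa> x y] by (simp add: q_def B_def)
  have "0 \<le> (\<Sum>i<d. (q i - (\<kappa> - 1) * (x i - y i))\<^sup>2)" by (simp add: sum_nonneg)
  also have "\<dots> = (\<Sum>i<d. (q i)\<^sup>2 - 2 * (\<kappa> - 1) * (q i * (x i - y i)) + (\<kappa> - 1)\<^sup>2 * (x i - y i)\<^sup>2)"
    by (intro sum.cong) (auto simp: power2_eq_square algebra_simps)
  also have "\<dots> = (\<Sum>i<d. (q i)\<^sup>2) - 2 * (\<kappa> - 1) * B + (\<kappa> - 1)\<^sup>2 * X"
    by (simp add: B_def X_def sum.distrib sum_subtractf sum_distrib_left)
  finally have "(\<kappa> - 1) * B \<le> (\<kappa> - 1) * ((\<kappa> - 1) * X)"
    using co by (simp add: power2_eq_square algebra_simps)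
  then have B: "B \<le> (\<kappa> - 1) * X" using \<kappa> by simp
  have "(\<Sum>i<d. (gradient U x i - gradient U y i)\<^sup>2)
      = (\<Sum>i<d. (q i)\<^sup>2 + 2 * (q i * (x i - y i)) + (x i - y i)\<^sup>2)"
    by (intro sum.cong) (auto simp: q_def power2_eq_square algebra_simps)
  also have "\<dots> = (\<Sum>i<d. (q i)\<^sup>2) + 2 * B + X"
    by (simp add: B_def X_def sum.distrib sum_distrib_left)
  also have "\<dots> \<le> (\<kappa> + 1) * B + X" using co by (simp add: algebra_simps)
  also have "\<dots> \<le> (\<kappa> + 1) * ((\<kappa> - 1) * X) + X" using B \<kappa> by simp
  also have "\<dots> = \<kappa>\<^sup>2 * X" by (simp add: power2_eq_square algebra_simps)
  finally have "sqrt (\<Sum>i<d. (gradient U x i - gradient U y i)\<^sup>2) \<le> sqrt (\<kappa>\<^sup>2 * X)"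
    by (rule real_sqrt_le_mono)
  then show ?thesis using \<kappa> by (simp add: L2_set_def real_sqrt_mult X_def)
qed

section \<open>Measurability and norms on phase space\<close>

text \<open>
  The product sigma-algebra on extensional functions is compared with the Borel sets of the
  product topology on all functions; the coordinates from \<open>d\<close> on are constant.
\<close>
lemma borel_measurable_borel_Rd:
  assumes "continuous_on (Rd d) (f :: (nat \<Rightarrow> real) \<Rightarrow> real)"
  shows "f \<in> borel_measurable (borel_Rd d)"
proof -
  have sp: "space (borel_Rd d) = Rd d" by (simp add: borel_Rd_def Rd_def space_PiM)
  have "(\<lambda>x. x) \<in> borel_Rd d \<rightarrow>\<^sub>M (\<Pi>\<^sub>M i\<in>(UNIV :: nat set). (borel :: real measure))"
  proof (rule measurable_PiM_single')
    fix i :: nat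
    show "(\<lambda>x. x i) \<in> borel_Rd d \<rightarrow>\<^sub>M borel"
    proof (cases "i < d")
      case True
      then show ?thesis unfolding borel_Rd_def by (intro measurable_component_singleton) simp
    next
      case False
      then have "x i = undefined" if "x \<in> space (borel_Rd d)" for x
        using that by (auto simp: sp Rd_def PiE_def extensional_def)
      then show ?thesis by (subst measurable_cong[where g = "\<lambda>_. undefined"]) auto
    qed
  qed auto
  then have "(\<lambda>x. x) \<in> borel_Rd d \<rightarrow>\<^sub>M borel"
    using measurable_cong_sets[OF refl sets_PiM_equal_borel] by blast
  then have "(\<lambda>x. x) \<in> borel_Rd d \<rightarrow>\<^sub>M restrict_space borel (Rd d)"
    by (rule measurable_restrict_space2[rotated]) (simp add: sp)
  from measurable_compose[OF this borel_measurable_continuous_on_restrict[OF assms]]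
  show ?thesis .
qed

lemma component_measurable: "i < d \<Longrightarrow> (\<lambda>x. x i) \<in> borel_measurable (borel_Rd d)"
  unfolding borel_Rd_def by (intro measurable_component_singleton) simp

lemma coordinate_measurable:
  assumes "i \<in> {..<d}"
  shows "(\<lambda>w. fst w i) \<in> borel_measurable (phase d)" "(\<lambda>w. snd w i) \<in> borel_measurable (phase d)"
proof -
  have "fst \<in> phase d \<rightarrow>\<^sub>M borel_Rd d" "snd \<in> phase d \<rightarrow>\<^sub>M borel_Rd d"
    by (simp_all add: phase_def)
  then show "(\<lambda>w. fst w i) \<in> borel_measurable (phase d)" "(\<lambda>w. snd w i) \<in> borel_measurable (phase d)"
    using assms component_measurable[of i d] by (auto intro: measurable_compose)
qed

lemma L2_set_cmult: "L2_set (\<lambda>i. c * f i) A = \<bar>c\<bar> * L2_set f A"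
  by (simp add: L2_set_def power_mult_distrib sum_distrib_left[symmetric] real_sqrt_mult)

lemma L2_set_diff_le: "L2_set (\<lambda>i. f i - g i) A \<le> L2_set f A + L2_set g A"
proof -
  have "L2_set (\<lambda>i. - g i) A = L2_set g A" by (simp add: L2_set_def)
  then show ?thesis using L2_set_triangle_ineq[of f "\<lambda>i. - g i" A] by simp
qed

section \<open>One step of the tuned chain\<close>

text \<open>
  The weight of the velocities equals the step size \<open>h = 1 / sqrt \<kappa>\<close> used below. It is the time
  scale on which a velocity moves the position, and it balances the two cross terms in the
  contraction estimate.
\<close>
definition weighted_dist :: "nat \<Rightarrow> real \<Rightarrow> phase_point \<Rightarrow> phase_point \<Rightarrow> real" where
  "weighted_dist d \<kappa> z w =
     L2_set (\<lambda>i. fst z i - fst w i) {..<d} + L2_set (\<lambda>i. snd z i - snd w i) {..<d} / sqrt \<kappa>"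

text \<open>
  The step size is half of the stability limit. The friction is so strong that the velocity keeps
  only the fraction \<open>r = 1 / (4 * \<kappa>)\<close> of its value over half a step. At \<open>r = 0\<close> the positions
  would be the unadjusted Langevin algorithm with gradient step \<open>h\<^sup>2 / 2 = 1 / (2 * \<kappa>)\<close>, which
  contracts by \<open>1 - 1 / (2 * \<kappa>)\<close>. This choice of \<open>r\<close> lets the velocity use up only half
  of that gain.
\<close>
locale tuned_obabo =
  fixes d :: nat and U :: "(nat \<Rightarrow> real) \<Rightarrow> real" and \<kappa> h \<gamma> :: real
  assumes U: "U \<in> U_class \<kappa> d" and \<kappa>: "1 < \<kappa>"
    and h: "h = 1 / sqrt \<kappa>" and \<gamma>: "exp (- \<gamma> * h / 2) = 1 / (4 * \<kappa>)"
begin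

definition r :: real where "r = 1 / (4 * \<kappa>)"
definition \<sigma> :: real where "\<sigma> = sqrt (1 - r\<^sup>2)"

abbreviation G where "G \<equiv> std_gaussian d \<Otimes>\<^sub>M std_gaussian d"
abbreviation step where "step \<equiv> obabo_step d U h \<gamma>"
abbreviation g where "g \<equiv> gradient U"

lemma r: "0 < r" "r < 1 / 4"
  using \<kappa> by (simp_all add: r_def field_simps)

lemma h_pos: "0 < h" and h2: "h\<^sup>2 * \<kappa> = 1"
  using \<kappa> by (simp_all add: h power_divide)

lemma \<sigma>: "5 / 6 \<le> \<sigma>"
proof -
  have "r\<^sup>2 \<le> (1 / 4)\<^sup>2" using r by (intro power_mono) auto
  then show ?thesis unfolding \<sigma>_def by (intro real_le_rsqrt) (simp add: power2_eq_square)
qed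

text \<open>
  The mean of the new position. In \<open>pos\<close> the first noise only translates it, and in \<open>vel\<close> the new
  velocity is written through the new position \<open>y\<close> instead of the first noise. In this form the
  dependence on the starting point is an additive constant in both components.
\<close>
definition drift :: "phase_point \<Rightarrow> nat \<Rightarrow> real" where
  "drift z i = fst z i + h * r * snd z i - h\<^sup>2 / 2 * g (fst z) i"

definition pos :: "phase_point \<Rightarrow> (nat \<Rightarrow> real) \<Rightarrow> nat \<Rightarrow> real" where
  "pos z \<xi> = (\<lambda>i\<in>{..<d}. drift z i + h * \<sigma> * \<xi> i)"

definition vel :: "phase_point \<Rightarrow> (nat \<Rightarrow> real) \<Rightarrow> (nat \<Rightarrow> real) \<Rightarrow> nat \<Rightarrow> real" where
  "vel z y \<eta> = (\<lambda>i\<in>{..<d}. r * ((y i - fst z i) / h - h / 2 * g y i) + \<sigma> * \<eta> i)"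

lemma step_eq: "step z \<xi> = (pos z (fst \<xi>), vel z (pos z (fst \<xi>)) (snd \<xi>))"
proof -
  obtain x v \<xi>1 \<xi>2 where z: "z = (x, v)" "\<xi> = (\<xi>1, \<xi>2)" by (metis surj_pair)
  have e: "exp (- (\<gamma> * h / 2)) = r" using \<gamma> by (simp add: r_def)
  have s: "sqrt (1 - r\<^sup>2) = \<sigma>" by (simp add: \<sigma>_def)
  define x' where "x' = (\<lambda>i\<in>{..<d}. x i + h * ((\<lambda>i\<in>{..<d}. (\<lambda>i\<in>{..<d}. r * v i + \<sigma> * \<xi>1 i) i - h / 2 * g x i) i))"
  have x': "x' = pos z \<xi>1"
    by (auto simp: x'_def pos_def drift_def z algebra_simps power2_eq_square)
  have "step z \<xi> = (x', \<lambda>i\<in>{..<d}. r * (\<lambda>i\<in>{..<d}. (\<lambda>i\<in>{..<d}. (\<lambda>i\<in>{..<d}. r * v i + \<sigma> * \<xi>1 i) i - h / 2 * g x i) i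
      - h / 2 * g x' i) i + \<sigma> * \<xi>2 i)"
    unfolding z obabo_step_def Let_def x'_def by (simp add: e s)
  also have "\<dots> = (x', vel z x' \<xi>2)"
  proof -
    have "r * v i + \<sigma> * \<xi>1 i - h / 2 * g x i = (x' i - x i) / h" if "i < d" for i
      using that h_pos by (simp add: x'_def)
    then show ?thesis by (auto simp: vel_def z)
  qed
  finally show ?thesis by (simp add: x' z)
qed

lemma space_phase: "space (phase d) = Rd d \<times> Rd d"
  by (simp add: phase_def borel_Rd_def Rd_def space_pair_measure space_PiM)

lemma grad_measurable: "i < d \<Longrightarrow> (\<lambda>x. g x i) \<in> borel_measurable (borel_Rd d)"
proof -
  assume i: "i < d"
  have "C_infinity d U" using U by (simp add: U_class_def)
  then show ?thesis
    using C_infinity_D(1)[OF C_infinity_D(3)[OF _ i]] unfolding gradient_def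
    by (intro borel_measurable_borel_Rd) auto
qed

lemma noise_measurable: "i < d \<Longrightarrow> (\<lambda>x. x i) \<in> borel_measurable (std_gaussian d)"
  unfolding std_gaussian_def using measurable_component_singleton[of i "{..<d}" "\<lambda>_. density lborel std_normal_density"]
  by simp

lemma step_measurable: "(\<lambda>(z, \<xi>). step z \<xi>) \<in> phase d \<Otimes>\<^sub>M G \<rightarrow>\<^sub>M phase d"
proof -
  note [measurable] = grad_measurable component_measurable noise_measurable
  have fst_m[measurable]: "fst \<in> phase d \<rightarrow>\<^sub>M borel_Rd d" and snd_m[measurable]: "snd \<in> phase d \<rightarrow>\<^sub>M borel_Rd d"
    by (simp_all add: phase_def)
  have pos_m[measurable]: "(\<lambda>p. pos (fst p) (fst (snd p))) \<in> phase d \<Otimes>\<^sub>M G \<rightarrow>\<^sub>M borel_Rd d"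
    unfolding pos_def drift_def borel_Rd_def[of d]
  proof (rule measurable_restrict)
    fix i assume "i \<in> {..<d}"
    then have [measurable]: "i < d" by simp
    show "(\<lambda>p. fst (fst p) i + h * r * snd (fst p) i - h\<^sup>2 / 2 * g (fst (fst p)) i + h * \<sigma> * fst (snd p) i)
        \<in> borel_measurable (phase d \<Otimes>\<^sub>M G)"
      by measurable
  qed
  have vel_m: "(\<lambda>p. vel (fst p) (pos (fst p) (fst (snd p))) (snd (snd p))) \<in> phase d \<Otimes>\<^sub>M G \<rightarrow>\<^sub>M borel_Rd d"
    unfolding vel_def borel_Rd_def[of d]
  proof (rule measurable_restrict)
    fix i assume "i \<in> {..<d}"
    then have [measurable]: "i < d" by simp
    show "(\<lambda>p. r * ((pos (fst p) (fst (snd p)) i - fst (fst p) i) / h - h / 2 * g (pos (fst p) (fst (snd p))) i)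
        + \<sigma> * snd (snd p) i) \<in> borel_measurable (phase d \<Otimes>\<^sub>M G)"
      by measurable
  qed
  show ?thesis
    unfolding step_eq split_beta using pos_m vel_m
    by (subst (2) phase_def) (rule measurable_Pair)
qed

lemma step_measurable1: "z \<in> space (phase d) \<Longrightarrow> step z \<in> G \<rightarrow>\<^sub>M phase d"
  using measurable_compose[OF measurable_Pair1' step_measurable] by simp

lemma pos_Rd: "pos z \<xi> \<in> Rd d"
  by (simp add: pos_def)

lemma drift_contracts:
  assumes "fst z \<in> Rd d" "fst w \<in> Rd d"
  shows "L2_set (\<lambda>i. drift z i - drift w i) {..<d}
    \<le> (1 - 1 / (2 * \<kappa>)) * L2_set (\<lambda>i. fst z i - fst w i) {..<d}
      + h * r * L2_set (\<lambda>i. snd z i - snd w i) {..<d}"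
proof -
  have t: "h\<^sup>2 / 2 = 1 / (2 * \<kappa>)" using h2 \<kappa> by (simp add: field_simps)
  have "L2_set (\<lambda>i. drift z i - drift w i) {..<d}
      = L2_set (\<lambda>i. (fst z i - fst w i - h\<^sup>2 / 2 * (g (fst z) i - g (fst w) i))
          + (h * r) * (snd z i - snd w i)) {..<d}"
    by (rule arg_cong[where f = "\<lambda>f. L2_set f {..<d}"]) (auto simp: drift_def algebra_simps)
  also have "\<dots> \<le> L2_set (\<lambda>i. fst z i - fst w i - h\<^sup>2 / 2 * (g (fst z) i - g (fst w) i)) {..<d}
      + L2_set (\<lambda>i. (h * r) * (snd z i - snd w i)) {..<d}"
    by (rule L2_set_triangle_ineq)
  also have "L2_set (\<lambda>i. fst z i - fst w i - h\<^sup>2 / 2 * (g (fst z) i - g (fst w) i)) {..<d}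
      \<le> (1 - h\<^sup>2 / 2) * L2_set (\<lambda>i. fst z i - fst w i) {..<d}"
    using \<kappa> h2 by (intro gradient_step_contracts[OF U \<kappa> assms]) auto
  also have "L2_set (\<lambda>i. (h * r) * (snd z i - snd w i)) {..<d} = h * r * L2_set (\<lambda>i. snd z i - snd w i) {..<d}"
    using h_pos r by (simp only: L2_set_cmult) simp
  finally show ?thesis unfolding t by simp
qed

text \<open>
  Both copies use the same noise, which cancels in the differences. The estimate reads
  \<open>X' \<le> (1 - 2 r) X + r (h V)\<close> and \<open>h V' \<le> r X + (3/2) r\<^sup>2 (h V)\<close> for the differences \<open>X\<close> of
  the positions and \<open>V\<close> of the velocities, and the two lines add up to a factor \<open>1 - r\<close>.
\<close>
lemma step_contracts:
  assumes z: "z \<in> space (phase d)" and w: "w \<in> space (phase d)"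
  shows "weighted_dist d \<kappa> (step z \<xi>) (step w \<xi>) \<le> (1 - 1 / (4 * \<kappa>)) * weighted_dist d \<kappa> z w"
proof -
  obtain \<xi>1 \<xi>2 where \<xi>: "\<xi> = (\<xi>1, \<xi>2)" by (metis surj_pair)
  define X where "X = L2_set (\<lambda>i. fst z i - fst w i) {..<d}"
  define V where "V = L2_set (\<lambda>i. snd z i - snd w i) {..<d}"
  define y where "y = pos z \<xi>1"
  define y' where "y' = pos w \<xi>1"
  define X' where "X' = L2_set (\<lambda>i. y i - y' i) {..<d}"
  define V' where "V' = L2_set (\<lambda>i. vel z y \<xi>2 i - vel w y' \<xi>2 i) {..<d}"
  have zw: "fst z \<in> Rd d" "fst w \<in> Rd d" using z w by (auto simp: space_phase)
  have nn: "0 \<le> X" "0 \<le> V" "0 \<le> X'" by (simp_all add: X_def V_def X'_def)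
  have lip: "L2_set (\<lambda>i. g a i - g b i) {..<d} \<le> \<kappa> * L2_set (\<lambda>i. a i - b i) {..<d}"
    if "a \<in> Rd d" "b \<in> Rd d" for a b
    using gradient_lipschitz[OF U \<kappa> that] .
  have X': "X' \<le> (1 - 1 / (2 * \<kappa>)) * X + h * r * V"
  proof -
    have "X' = L2_set (\<lambda>i. drift z i - drift w i) {..<d}"
      unfolding X'_def y_def y'_def by (intro L2_set_cong) (auto simp: pos_def)
    then show ?thesis using drift_contracts[OF zw] by (simp add: X_def V_def)
  qed
  have V': "V' \<le> r * (r * V + h / 2 * (\<kappa> * X) + h / 2 * (\<kappa> * X'))"
  proof -
    have "V' = L2_set (\<lambda>i. r * (r * (snd z i - snd w i)
        - h / 2 * (g (fst z) i - g (fst w) i) - h / 2 * (g y i - g y' i))) {..<d}"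
      unfolding V'_def
    proof (intro L2_set_cong refl)
      fix i assume "i \<in> {..<d}"
      then have yz: "(y i - fst z i) / h = r * snd z i - h / 2 * g (fst z) i + \<sigma> * \<xi>1 i"
        and yw: "(y' i - fst w i) / h = r * snd w i - h / 2 * g (fst w) i + \<sigma> * \<xi>1 i"
        using h_pos by (simp_all add: y_def y'_def pos_def drift_def power2_eq_square field_simps)
      show "vel z y \<xi>2 i - vel w y' \<xi>2 i = r * (r * (snd z i - snd w i)
        - h / 2 * (g (fst z) i - g (fst w) i) - h / 2 * (g y i - g y' i))"
        by (simp only: vel_def restrict_apply'[OF \<open>i \<in> {..<d}\<close>] yz yw) (simp add: algebra_simps)
    qed
    also have "\<dots> = r * L2_set (\<lambda>i. r * (snd z i - snd w i)
        - h / 2 * (g (fst z) i - g (fst w) i) - h / 2 * (g y i - g y' i)) {..<d}"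
      using r by (simp add: L2_set_cmult)
    also have "\<dots> \<le> r * (r * V + h / 2 * (\<kappa> * X) + h / 2 * (\<kappa> * X'))"
    proof (intro mult_left_mono)
      have "L2_set (\<lambda>i. r * (snd z i - snd w i)
          - h / 2 * (g (fst z) i - g (fst w) i) - h / 2 * (g y i - g y' i)) {..<d}
        \<le> L2_set (\<lambda>i. r * (snd z i - snd w i) - h / 2 * (g (fst z) i - g (fst w) i)) {..<d}
          + L2_set (\<lambda>i. h / 2 * (g y i - g y' i)) {..<d}"
        by (rule L2_set_diff_le)
      also have "L2_set (\<lambda>i. r * (snd z i - snd w i) - h / 2 * (g (fst z) i - g (fst w) i)) {..<d}
        \<le> L2_set (\<lambda>i. r * (snd z i - snd w i)) {..<d}
          + L2_set (\<lambda>i. h / 2 * (g (fst z) i - g (fst w) i)) {..<d}"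
        by (rule L2_set_diff_le)
      also have "L2_set (\<lambda>i. r * (snd z i - snd w i)) {..<d} = r * V"
        using r by (simp add: L2_set_cmult V_def)
      also have "L2_set (\<lambda>i. h / 2 * (g (fst z) i - g (fst w) i)) {..<d} \<le> h / 2 * (\<kappa> * X)"
        using h_pos lip[OF zw] by (simp only: L2_set_cmult X_def) simp
      also have "L2_set (\<lambda>i. h / 2 * (g y i - g y' i)) {..<d} \<le> h / 2 * (\<kappa> * X')"
        using h_pos lip[of y y'] by (simp only: L2_set_cmult X'_def) (simp add: y_def y'_def pos_Rd)
      finally show "L2_set (\<lambda>i. r * (snd z i - snd w i)
          - h / 2 * (g (fst z) i - g (fst w) i) - h / 2 * (g y i - g y' i)) {..<d}
        \<le> r * V + h / 2 * (\<kappa> * X) + h / 2 * (\<kappa> * X')" by simp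
    qed (use r in simp)
    finally show ?thesis .
  qed
  have hk: "h * (h * \<kappa>) = 1" using h2 by (simp add: power2_eq_square mult_ac)
  have "h * V' \<le> h * (r * (r * V + h / 2 * (\<kappa> * X) + h / 2 * (\<kappa> * X')))"
    using V' h_pos by (intro mult_left_mono) auto
  also have "\<dots> = r\<^sup>2 * (h * V) + (h * (h * \<kappa>)) * (r / 2) * X + (h * (h * \<kappa>)) * (r / 2) * X'"
    by (simp add: power2_eq_square algebra_simps)
  also have "\<dots> = r\<^sup>2 * (h * V) + r / 2 * X + r / 2 * X'" unfolding hk by simp
  also have "r / 2 * X' \<le> r / 2 * (X + r * (h * V))"
  proof (intro mult_left_mono)
    have "(1 - 1 / (2 * \<kappa>)) * X \<le> X" using nn \<kappa> by (simp add: mult_left_le_one_le)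
    then show "X' \<le> X + r * (h * V)" using X' by (simp add: mult_ac)
  qed (use r in simp)
  finally have hV: "h * V' \<le> (3 / 2 * r\<^sup>2) * (h * V) + r * X"
    by (simp add: power2_eq_square algebra_simps)
  have "weighted_dist d \<kappa> (step z \<xi>) (step w \<xi>) = X' + V' / sqrt \<kappa>"
    by (simp add: weighted_dist_def step_eq \<xi> X'_def V'_def y_def y'_def)
  also have "\<dots> = X' + h * V'" by (simp add: h)
  also have "\<dots> \<le> (1 - 2 * r) * X + r * (h * V) + ((3 / 2 * r\<^sup>2) * (h * V) + r * X)"
    using X' hV by (simp add: r_def mult_ac)
  also have "\<dots> = (1 - r) * X + (r + 3 / 2 * r\<^sup>2) * (h * V)" by (simp add: algebra_simps)
  also have "(r + 3 / 2 * r\<^sup>2) * (h * V) \<le> (1 - r) * (h * V)"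
  proof (intro mult_right_mono)
    have "r\<^sup>2 \<le> r * (1 / 4)" unfolding power2_eq_square using r by (intro mult_left_mono) auto
    then show "r + 3 / 2 * r\<^sup>2 \<le> 1 - r" using r by linarith
  qed (use nn h_pos in simp)
  also have "(1 - r) * X + (1 - r) * (h * V) = (1 - 1 / (4 * \<kappa>)) * weighted_dist d \<kappa> z w"
    by (simp add: weighted_dist_def r_def X_def V_def h algebra_simps)
  finally show ?thesis by simp
qed

text \<open>
  The step from \<open>z\<close> with noise \<open>\<xi>\<close> is the step from \<open>w\<close> with noise \<open>\<xi> + (a, b)\<close>, where the shift
  \<open>(a, b)\<close> does not depend on \<open>\<xi>\<close>: \<open>a\<close> makes the new positions agree, and then the velocities
  differ by the constant \<open>r * (fst w - fst z) / h\<close>, which \<open>b\<close> removes. So the two kernels differ as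
  a Gaussian law differs from its translate.
\<close>
lemma kernel_smoothing:
  assumes z: "z \<in> space (phase d)" and w: "w \<in> space (phase d)" and A[measurable]: "A \<in> sets (phase d)"
  shows "\<bar>measure (distr G (phase d) (step z)) A - measure (distr G (phase d) (step w)) A\<bar>
    \<le> 3 * sqrt \<kappa> * weighted_dist d \<kappa> z w"
proof -
  define a where "a i = 1 / (h * \<sigma>) * (drift z i - drift w i)" for i
  define b where "b i = r / (h * \<sigma>) * (fst w i - fst z i)" for i
  define X where "X = L2_set (\<lambda>i. fst z i - fst w i) {..<d}"
  define V where "V = L2_set (\<lambda>i. snd z i - snd w i) {..<d}"
  have zw: "fst z \<in> Rd d" "fst w \<in> Rd d" using z w by (auto simp: space_phase)
  have nn: "0 \<le> X" "0 \<le> V" by (simp_all add: X_def V_def)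
  have \<sigma>0: "0 < \<sigma>" using \<sigma> by simp
  have shift: "step z \<xi> = step w (\<lambda>i\<in>{..<d}. fst \<xi> i + a i, \<lambda>i\<in>{..<d}. snd \<xi> i + b i)" for \<xi>
  proof -
    have p: "pos z (fst \<xi>) = pos w (\<lambda>i\<in>{..<d}. fst \<xi> i + a i)"
      using h_pos \<sigma>0 by (auto simp: pos_def a_def field_simps)
    have "vel z y (snd \<xi>) = vel w y (\<lambda>i\<in>{..<d}. snd \<xi> i + b i)" for y
      using h_pos \<sigma>0 by (auto simp: vel_def b_def field_simps)
    then show ?thesis by (simp add: step_eq p)
  qed
  define F where "F \<xi> = (indicator A (step w \<xi>) :: real)" for \<xi>
  have F: "F \<in> borel_measurable G"
    unfolding F_def by (rule measurable_compose[OF step_measurable1[OF w]]) measurable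
  have m: "measure (distr G (phase d) (step u)) A = (\<integral>\<xi>. indicator A (step u \<xi>) \<partial>G)"
    if "u \<in> space (phase d)" for u
    using A step_measurable1[OF that]
    by (subst integral_distr[symmetric, of _ G "phase d" "indicator A :: _ \<Rightarrow> real"]) auto
  have "\<bar>measure (distr G (phase d) (step z)) A - measure (distr G (phase d) (step w)) A\<bar>
      = \<bar>(\<integral>\<xi>. F (\<lambda>i\<in>{..<d}. fst \<xi> i + a i, \<lambda>i\<in>{..<d}. snd \<xi> i + b i) \<partial>G) - (\<integral>\<xi>. F \<xi> \<partial>G)\<bar>"
    unfolding m[OF z] m[OF w] F_def shift ..
  also have "\<dots> \<le> 2 * (L2_set a {..<d} + L2_set b {..<d})"
    by (rule gaussian_pair_shift_tv[OF F]) (auto simp: F_def indicator_def)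
  finally have tv: "\<bar>measure (distr G (phase d) (step z)) A - measure (distr G (phase d) (step w)) A\<bar>
      \<le> 2 * (L2_set a {..<d} + L2_set b {..<d})" .
  have fst_shift: "L2_set a {..<d} \<le> sqrt \<kappa> / \<sigma> * (X + V / sqrt \<kappa>)"
  proof -
    have "L2_set a {..<d} = 1 / (h * \<sigma>) * L2_set (\<lambda>i. drift z i - drift w i) {..<d}"
      using h_pos \<sigma>0 unfolding a_def by (simp only: L2_set_cmult) simp
    also have "\<dots> \<le> 1 / (h * \<sigma>) * (X + V / sqrt \<kappa>)"
    proof (intro mult_left_mono)
      have "(1 - 1 / (2 * \<kappa>)) * X \<le> X" using nn \<kappa> by (simp add: mult_left_le_one_le)
      moreover have "h * r * V \<le> h * 1 * V"
        using r nn h_pos by (intro mult_right_mono mult_left_mono) auto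
      ultimately show "L2_set (\<lambda>i. drift z i - drift w i) {..<d} \<le> X + V / sqrt \<kappa>"
        using drift_contracts[OF zw] by (simp add: X_def V_def h)
    qed (use h_pos \<sigma>0 in simp)
    finally show ?thesis by (simp add: h)
  qed
  have snd_shift: "L2_set b {..<d} \<le> 1 / 4 * (sqrt \<kappa> / \<sigma> * (X + V / sqrt \<kappa>))"
  proof -
    have "L2_set b {..<d} = r / (h * \<sigma>) * X"
      using h_pos \<sigma>0 r unfolding b_def X_def
      by (simp only: L2_set_cmult) (simp add: L2_set_def power2_commute)
    also have "\<dots> = sqrt \<kappa> / \<sigma> * r * X" by (simp add: h)
    also have "\<dots> \<le> sqrt \<kappa> / \<sigma> * (1 / 4) * (X + V / sqrt \<kappa>)"
      using r nn \<sigma>0 \<kappa> by (intro mult_mono mult_left_mono) auto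
    also have "\<dots> = 1 / 4 * (sqrt \<kappa> / \<sigma> * (X + V / sqrt \<kappa>))" by simp
    finally show ?thesis .
  qed
  have noise: "sqrt \<kappa> / \<sigma> * (X + V / sqrt \<kappa>) \<le> 6 / 5 * sqrt \<kappa> * (X + V / sqrt \<kappa>)"
  proof (intro mult_right_mono)
    have "1 / \<sigma> \<le> 6 / 5" using \<sigma> \<sigma>0 by (simp add: field_simps)
    from mult_right_mono[OF this, of "sqrt \<kappa>"] show "sqrt \<kappa> / \<sigma> \<le> 6 / 5 * sqrt \<kappa>" using \<kappa> by simp
  qed (use nn \<kappa> in simp)
  have "2 * (l + m) \<le> 3 * sqrt \<kappa> * (X + V / sqrt \<kappa>)"
    if "l \<le> q" "m \<le> 1 / 4 * q" "q \<le> 6 / 5 * sqrt \<kappa> * (X + V / sqrt \<kappa>)" for l m q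
    using that by simp
  from this[OF fst_shift snd_shift noise] show ?thesis
    using tv by (simp only: weighted_dist_def X_def V_def)
qed

definition origin :: phase_point where
  "origin = (\<lambda>i\<in>{..<d}. 0, \<lambda>i\<in>{..<d}. 0)"

lemma origin_space: "origin \<in> space (phase d)"
  by (simp add: origin_def space_phase)

lemma weighted_dist_measurable: "weighted_dist d \<kappa> z \<in> borel_measurable (phase d)"
proof -
  note [measurable] = coordinate_measurable
  show ?thesis unfolding weighted_dist_def L2_set_def by measurable
qed

text \<open>
  Lipschitz dependence on the noise, so that the Gaussian first moments pass to the step.
\<close>
lemma noise_displacement:
  "weighted_dist d \<kappa> (step z (\<lambda>_. 0, \<lambda>_. 0)) (step z \<xi>)
    \<le> (h * \<sigma> + (r / h + r * (h / 2) * \<kappa>) * (h * \<sigma>)) * L2_set (fst \<xi>) {..<d} + \<sigma> * L2_set (snd \<xi>) {..<d}"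
proof -
  define y where "y = pos z (\<lambda>_. 0)"
  define y' where "y' = pos z (fst \<xi>)"
  have \<sigma>0: "0 < \<sigma>" using \<sigma> by simp
  have Y: "L2_set (\<lambda>i. y i - y' i) {..<d} = h * \<sigma> * L2_set (fst \<xi>) {..<d}"
  proof -
    have "L2_set (\<lambda>i. y i - y' i) {..<d} = L2_set (\<lambda>i. (- (h * \<sigma>)) * fst \<xi> i) {..<d}"
      by (intro L2_set_cong) (auto simp: y_def y'_def pos_def)
    then show ?thesis using h_pos \<sigma>0 by (simp only: L2_set_cmult) simp
  qed
  have "L2_set (\<lambda>i. vel z y (\<lambda>_. 0) i - vel z y' (snd \<xi>) i) {..<d}
      = L2_set (\<lambda>i. (r / h) * (y i - y' i) - (r * (h / 2)) * (g y i - g y' i) - \<sigma> * snd \<xi> i) {..<d}"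
    using h_pos by (intro L2_set_cong) (auto simp: vel_def field_simps)
  also have "\<dots> \<le> L2_set (\<lambda>i. (r / h) * (y i - y' i) - (r * (h / 2)) * (g y i - g y' i)) {..<d}
      + L2_set (\<lambda>i. \<sigma> * snd \<xi> i) {..<d}"
    by (rule L2_set_diff_le)
  also have "L2_set (\<lambda>i. \<sigma> * snd \<xi> i) {..<d} = \<sigma> * L2_set (snd \<xi>) {..<d}"
    using \<sigma>0 by (simp add: L2_set_cmult)
  also have "L2_set (\<lambda>i. (r / h) * (y i - y' i) - (r * (h / 2)) * (g y i - g y' i)) {..<d}
      \<le> L2_set (\<lambda>i. (r / h) * (y i - y' i)) {..<d} + L2_set (\<lambda>i. (r * (h / 2)) * (g y i - g y' i)) {..<d}"
    by (rule L2_set_diff_le)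
  also have "L2_set (\<lambda>i. (r / h) * (y i - y' i)) {..<d} = r / h * L2_set (\<lambda>i. y i - y' i) {..<d}"
    using r h_pos by (simp only: L2_set_cmult) simp
  also have "L2_set (\<lambda>i. (r * (h / 2)) * (g y i - g y' i)) {..<d}
      \<le> r * (h / 2) * (\<kappa> * L2_set (\<lambda>i. y i - y' i) {..<d})"
    using r h_pos gradient_lipschitz[OF U \<kappa>, of y y']
    by (simp only: L2_set_cmult) (simp add: y_def y'_def pos_Rd)
  finally have "L2_set (\<lambda>i. vel z y (\<lambda>_. 0) i - vel z y' (snd \<xi>) i) {..<d}
      \<le> (r / h + r * (h / 2) * \<kappa>) * (h * \<sigma> * L2_set (fst \<xi>) {..<d}) + \<sigma> * L2_set (snd \<xi>) {..<d}"
    (is "?V \<le> ?B") unfolding Y by (simp add: algebra_simps)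
  moreover have "?V / sqrt \<kappa> \<le> ?V / 1"
    using \<kappa> by (intro divide_left_mono) auto
  moreover have "weighted_dist d \<kappa> (step z (\<lambda>_. 0, \<lambda>_. 0)) (step z \<xi>)
      = h * \<sigma> * L2_set (fst \<xi>) {..<d} + ?V / sqrt \<kappa>"
    unfolding Y[symmetric] by (simp add: weighted_dist_def step_eq y_def y'_def)
  moreover have "(a + b * a) * s = a * s + b * (a * s)" for a b s :: real
    by (simp add: algebra_simps)
  ultimately show ?thesis by simp
qed

lemma weighted_dist_triangle:
  "weighted_dist d \<kappa> z w \<le> weighted_dist d \<kappa> z u + weighted_dist d \<kappa> u w"
proof -
  have "L2_set (\<lambda>i. a i - c i) {..<d} \<le> L2_set (\<lambda>i. a i - b i) {..<d} + L2_set (\<lambda>i. b i - c i) {..<d}"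
    for a b c :: "nat \<Rightarrow> real"
    using L2_set_triangle_ineq[of "\<lambda>i. a i - b i" "\<lambda>i. b i - c i"] by simp
  from this[of "fst z" "fst w" "fst u"] divide_right_mono[OF this[of "snd z" "snd w" "snd u"], of "sqrt \<kappa>"]
  show ?thesis using \<kappa> by (simp add: weighted_dist_def add_divide_distrib)
qed

lemma weighted_dist_nonneg: "0 \<le> weighted_dist d \<kappa> z w"
  using \<kappa> by (simp add: weighted_dist_def)

lemma first_moment: "integrable G (\<lambda>\<xi>. weighted_dist d \<kappa> origin (step origin \<xi>))"
proof -
  define C0 where "C0 = weighted_dist d \<kappa> origin (step origin (\<lambda>_. 0, \<lambda>_. 0))"
  define C1 where "C1 = h * \<sigma> + (r / h + r * (h / 2) * \<kappa>) * (h * \<sigma>)"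
  have C1: "0 \<le> C1" and \<sigma>0: "0 \<le> \<sigma>" using h_pos \<sigma> r \<kappa> by (auto simp: C1_def)
  interpret G: prob_space "std_gaussian d" by (rule prob_space_std_gaussian)
  interpret GG: pair_prob_space "std_gaussian d" "std_gaussian d" ..
  have dfst: "distr G (std_gaussian d) fst = std_gaussian d"
    by (rule G.distr_pair_fst)
  have dsnd: "distr G (std_gaussian d) snd = std_gaussian d"
  proof -
    have "distr G (std_gaussian d) snd = distr (distr G G (\<lambda>(x, y). (y, x))) (std_gaussian d) fst"
      by (subst distr_distr) (auto simp: o_def split_beta)
    then show ?thesis using GG.distr_pair_swap dfst by simp
  qed
  have ifst: "integrable G (\<lambda>\<xi>. \<bar>fst \<xi> i\<bar>)" if "i < d" for i
    using gaussian_coordinate_integrable[OF that] noise_measurable[OF that]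
    by (subst (asm) dfst[symmetric], subst (asm) integrable_distr_eq) auto
  have isnd: "integrable G (\<lambda>\<xi>. \<bar>snd \<xi> i\<bar>)" if "i < d" for i
    using gaussian_coordinate_integrable[OF that] noise_measurable[OF that]
    by (subst (asm) dsnd[symmetric], subst (asm) integrable_distr_eq) auto
  have bound: "weighted_dist d \<kappa> origin (step origin \<xi>)
      \<le> C0 + C1 * (\<Sum>i<d. \<bar>fst \<xi> i\<bar>) + \<sigma> * (\<Sum>i<d. \<bar>snd \<xi> i\<bar>)" for \<xi>
  proof -
    have "C1 * L2_set (fst \<xi>) {..<d} \<le> C1 * (\<Sum>i<d. \<bar>fst \<xi> i\<bar>)"
      "\<sigma> * L2_set (snd \<xi>) {..<d} \<le> \<sigma> * (\<Sum>i<d. \<bar>snd \<xi> i\<bar>)"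
      using C1 \<sigma>0 by (auto intro!: mult_left_mono L2_set_le_sum_abs)
    then show ?thesis
      using weighted_dist_triangle[of origin "step origin \<xi>" "step origin (\<lambda>_. 0, \<lambda>_. 0)"]
        noise_displacement[of origin \<xi>] unfolding C0_def[symmetric] C1_def[symmetric] by linarith
  qed
  show ?thesis
  proof (rule Bochner_Integration.integrable_bound)
    show "integrable G (\<lambda>\<xi>. C0 + C1 * (\<Sum>i<d. \<bar>fst \<xi> i\<bar>) + \<sigma> * (\<Sum>i<d. \<bar>snd \<xi> i\<bar>))"
      using ifst isnd by (intro Bochner_Integration.integrable_add integrable_mult_right
          Bochner_Integration.integrable_sum GG.integrable_const) auto
    show "(\<lambda>\<xi>. weighted_dist d \<kappa> origin (step origin \<xi>)) \<in> borel_measurable G"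
      by (rule measurable_compose[OF step_measurable1[OF origin_space] weighted_dist_measurable])
    show "AE \<xi> in G. norm (weighted_dist d \<kappa> origin (step origin \<xi>))
        \<le> norm (C0 + C1 * (\<Sum>i<d. \<bar>fst \<xi> i\<bar>) + \<sigma> * (\<Sum>i<d. \<bar>snd \<xi> i\<bar>))"
    proof (rule AE_I2)
      fix \<xi>
      show "norm (weighted_dist d \<kappa> origin (step origin \<xi>))
        \<le> norm (C0 + C1 * (\<Sum>i<d. \<bar>fst \<xi> i\<bar>) + \<sigma> * (\<Sum>i<d. \<bar>snd \<xi> i\<bar>))"
        using bound[of \<xi>] weighted_dist_nonneg[of origin "step origin \<xi>"]
        unfolding real_norm_def by linarith
    qed
  qed
qed

sublocale contractive_random_map "phase d" G step "weighted_dist d \<kappa>" "1 - 1 / (4 * \<kappa>)" "3 * sqrt \<kappa>" origin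
proof (rule contractive_random_map.intro)
  interpret G: prob_space "std_gaussian d" by (rule prob_space_std_gaussian)
  interpret GG: pair_prob_space "std_gaussian d" "std_gaussian d" ..
  show "prob_space G" by (rule GG.prob_space_axioms)
  show "0 \<le> 1 - 1 / (4 * \<kappa>)" "1 - 1 / (4 * \<kappa>) < 1" "0 \<le> 3 * sqrt \<kappa>"
    using \<kappa> by (auto simp: field_simps)
  show "weighted_dist d \<kappa> (step z \<xi>) (step w \<xi>) \<le> (1 - 1 / (4 * \<kappa>)) * weighted_dist d \<kappa> z w"
    if "z \<in> space (phase d)" "w \<in> space (phase d)" for z w \<xi>
    using that by (rule step_contracts)
  show "\<bar>measure (distr G (phase d) (step z)) A - measure (distr G (phase d) (step w)) A\<bar>
      \<le> 3 * sqrt \<kappa> * weighted_dist d \<kappa> z w"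
    if "z \<in> space (phase d)" "w \<in> space (phase d)" "A \<in> sets (phase d)" for z w A
    using that by (rule kernel_smoothing)
  show "(\<lambda>(z, \<xi>). step z \<xi>) \<in> phase d \<Otimes>\<^sub>M G \<rightarrow>\<^sub>M phase d" by (rule step_measurable)
  show "0 \<le> weighted_dist d \<kappa> z w" for z w by (rule weighted_dist_nonneg)
  show "weighted_dist d \<kappa> z \<in> borel_measurable (phase d)" for z by (rule weighted_dist_measurable)
  show "origin \<in> space (phase d)" by (rule origin_space)
  show "integrable G (\<lambda>\<xi>. weighted_dist d \<kappa> origin (step origin \<xi>))" by (rule first_moment)
qed

end

section \<open>Distance to an invariant law\<close>

lemma phase_dist_measurable: "phase_dist d z \<in> borel_measurable (phase d)"
proof -
  note [measurable] = coordinate_measurable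
  show ?thesis unfolding phase_dist_def by measurable
qed

lemma weighted_dist_le:
  assumes "1 \<le> \<kappa>"
  shows "weighted_dist d \<kappa> z w \<le> 2 * phase_dist d z w"
proof -
  have "L2_set (\<lambda>i. fst z i - fst w i) {..<d} \<le> phase_dist d z w"
    "L2_set (\<lambda>i. snd z i - snd w i) {..<d} \<le> phase_dist d z w"
    unfolding L2_set_def phase_dist_def by (auto intro!: real_sqrt_le_mono sum_nonneg)
  moreover have "L2_set (\<lambda>i. snd z i - snd w i) {..<d} / sqrt \<kappa> \<le> L2_set (\<lambda>i. snd z i - snd w i) {..<d} / 1"
    using assms by (intro divide_left_mono) auto
  ultimately show ?thesis by (simp add: weighted_dist_def)
qed

text \<open>
  The first marginal of a coupling with a Dirac mass is almost surely at the atom. This is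
  expressed through the vanishing of \<open>phase_dist d z\<close>, which is a measurable condition.
\<close>
lemma W2_cost_Dirac:
  assumes z: "z \<in> space (phase d)" and \<pi>: "prob_space \<pi>" "sets \<pi> = sets (phase d)"
  shows "(\<integral>\<^sup>+w. ennreal ((phase_dist d z w)\<^sup>2) \<partial>\<pi>) \<le> W2_cost d (return (phase d) z) \<pi>"
  unfolding W2_cost_def
proof (rule INF_greatest)
  let ?\<delta> = "return (phase d) z"
  fix \<rho> assume "\<rho> \<in> couplings ?\<delta> \<pi>"
  then have sets_\<rho>: "sets \<rho> = sets (?\<delta> \<Otimes>\<^sub>M \<pi>)"
    and fst_\<rho>: "distr \<rho> ?\<delta> fst = ?\<delta>" and snd_\<rho>: "distr \<rho> \<pi> snd = \<pi>"
    by (auto simp: couplings_def)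
  have fst_m: "fst \<in> \<rho> \<rightarrow>\<^sub>M ?\<delta>" and snd_m: "snd \<in> \<rho> \<rightarrow>\<^sub>M \<pi>"
    unfolding measurable_cong_sets[OF sets_\<rho> refl] by (rule measurable_fst, rule measurable_snd)
  note [measurable] = phase_dist_measurable[of d z]
  have "Measurable.pred (phase d) (\<lambda>w. phase_dist d z w = 0)" by measurable
  from AE_return[OF z this] have "AE w in ?\<delta>. phase_dist d z w = 0"
    by (simp add: phase_dist_def)
  then have "AE w in distr \<rho> ?\<delta> fst. phase_dist d z w = 0" by (simp only: fst_\<rho>)
  from AE_distrD[OF fst_m this] have "AE p in \<rho>. phase_dist d z (fst p) = 0" .
  then have ae: "AE p in \<rho>. phase_dist d z (snd p) = phase_dist d (fst p) (snd p)"
  proof eventually_elim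
    case (elim p)
    have "(\<Sum>i<d. (fst z i - fst (fst p) i)\<^sup>2) = 0 \<and> (\<Sum>i<d. (snd z i - snd (fst p) i)\<^sup>2) = 0"
      using elim by (simp add: phase_dist_def sum_nonneg add_nonneg_eq_0_iff)
    then have "fst z i = fst (fst p) i \<and> snd z i = snd (fst p) i" if "i < d" for i
      using that by (simp add: sum_nonneg_eq_0_iff)
    then show ?case by (simp add: phase_dist_def)
  qed
  have "(\<integral>\<^sup>+w. ennreal ((phase_dist d z w)\<^sup>2) \<partial>\<pi>) = (\<integral>\<^sup>+w. ennreal ((phase_dist d z w)\<^sup>2) \<partial>distr \<rho> \<pi> snd)"
    by (simp add: snd_\<rho>)
  also have "\<dots> = (\<integral>\<^sup>+p. ennreal ((phase_dist d z (snd p))\<^sup>2) \<partial>\<rho>)"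
    using snd_m by (rule nn_integral_distr) (simp add: measurable_cong_sets[OF \<pi>(2) refl])
  also have "\<dots> = (\<integral>\<^sup>+p. (case p of (z, z') \<Rightarrow> ennreal ((phase_dist d z z')\<^sup>2)) \<partial>\<rho>)"
    using ae by (intro nn_integral_cong_AE) (auto elim!: eventually_mono)
  finally show "(\<integral>\<^sup>+w. ennreal ((phase_dist d z w)\<^sup>2) \<partial>\<pi>)
      \<le> (\<integral>\<^sup>+p. (case p of (z, z') \<Rightarrow> ennreal ((phase_dist d z z')\<^sup>2)) \<partial>\<rho>)"
    by simp
qed

text \<open>
  From \<open>D \<le> (t + D\<^sup>2 / t) / 2\<close> with \<open>t = 1 + W\<^sub>2\<close>, the mean of \<open>D\<close> is at most \<open>t\<close>. An infinite
  distance makes the right-hand side infinite.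
\<close>
lemma expected_dist_le_W2:
  assumes z: "z \<in> space (phase d)" and \<pi>: "prob_space \<pi>" "sets \<pi> = sets (phase d)"
  shows "(\<integral>\<^sup>+w. ennreal (phase_dist d z w) \<partial>\<pi>) \<le> 1 + W2 d (return (phase d) z) \<pi>"
proof (cases "W2_cost d (return (phase d) z) \<pi> = \<infinity>")
  case True
  then show ?thesis by (simp add: W2_def)
next
  case False
  define c where "c = enn2real (W2_cost d (return (phase d) z) \<pi>)"
  have c: "0 \<le> c" "W2_cost d (return (phase d) z) \<pi> = ennreal c"
    using False by (auto simp: c_def less_top)
  define t where "t = 1 + sqrt c"
  have t: "1 \<le> t" "c \<le> t * t" using c(1) by (auto simp: t_def algebra_simps)
  have [measurable]: "phase_dist d z \<in> borel_measurable \<pi>"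
    using phase_dist_measurable measurable_cong_sets[OF \<pi>(2) refl] by blast
  have "(\<integral>\<^sup>+w. ennreal (phase_dist d z w) \<partial>\<pi>)
      \<le> (\<integral>\<^sup>+w. ennreal (t / 2) + ennreal (1 / (2 * t)) * ennreal ((phase_dist d z w)\<^sup>2) \<partial>\<pi>)"
  proof (intro nn_integral_mono)
    fix w
    have "0 \<le> (t - phase_dist d z w)\<^sup>2" by simp
    then have "phase_dist d z w \<le> t / 2 + 1 / (2 * t) * (phase_dist d z w)\<^sup>2"
      using t by (simp add: field_simps power2_eq_square)
    then show "ennreal (phase_dist d z w)
        \<le> ennreal (t / 2) + ennreal (1 / (2 * t)) * ennreal ((phase_dist d z w)\<^sup>2)"
      using t by (simp add: ennreal_mult[symmetric] ennreal_plus[symmetric] ennreal_leI del: ennreal_plus)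
  qed
  also have "\<dots> = ennreal (t / 2) + ennreal (1 / (2 * t)) * (\<integral>\<^sup>+w. ennreal ((phase_dist d z w)\<^sup>2) \<partial>\<pi>)"
    using prob_space.emeasure_space_1[OF \<pi>(1)]
    by (subst nn_integral_add) (auto simp: nn_integral_cmult)
  also have "\<dots> \<le> ennreal (t / 2) + ennreal (1 / (2 * t)) * ennreal c"
    using W2_cost_Dirac[OF z \<pi>] c(2) by (intro add_left_mono mult_left_mono) auto
  also have "\<dots> = ennreal (t / 2 + 1 / (2 * t) * c)"
    using t c by (simp add: ennreal_mult[symmetric] ennreal_plus[symmetric] del: ennreal_plus)
  also have "\<dots> \<le> ennreal t"
  proof (rule ennreal_leI)
    have "1 / (2 * t) * c \<le> 1 / (2 * t) * (t * t)" using t by (intro mult_left_mono) auto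
    then show "t / 2 + 1 / (2 * t) * c \<le> t" using t by simp
  qed
  also have "\<dots> = 1 + W2 d (return (phase d) z) \<pi>"
    using False c by (simp add: W2_def c_def[symmetric] t_def)
  finally show ?thesis .
qed

lemma tv_dist_leI:
  assumes "\<And>A. A \<in> sets \<mu> \<Longrightarrow> ennreal \<bar>measure \<mu> A - measure \<nu> A\<bar> \<le> B"
  shows "ennreal (tv_dist \<mu> \<nu>) \<le> B"
proof (cases B)
  case (real b)
  have "tv_dist \<mu> \<nu> \<le> b"
    unfolding tv_dist_def using assms real sets.top[of \<mu>] by (intro cSUP_least) auto
  then show ?thesis using real by (simp add: ennreal_leI)
qed simp

section \<open>Convergence of the tuned chain\<close>

context tuned_obabo
begin

lemma kernel_eq: "obabo_kernel d U h \<gamma> = Q"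
  by (rule ext) (simp add: obabo_kernel_def Q_def)

text \<open>
  After the first step the constant is \<open>3 * sqrt \<kappa>\<close> times a factor 2 from the comparison with
  the Euclidean distance. Replacing \<open>\<rho> ^ m\<close> by \<open>\<rho> ^ Suc m\<close> costs at most \<open>4 / 3\<close>, since
  \<open>\<rho> \<ge> 3 / 4\<close>. At time 0 the trivial bound by 1 is enough.
\<close>
lemma tv_rate:
  assumes inv: "invariant_law (phase d) Q \<pi>" and z: "z \<in> space (phase d)"
  shows "ennreal (tv_dist (P n z) \<pi>)
    \<le> ennreal (8 * \<kappa>) * (1 + W2 d (return (phase d) z) \<pi>) * ennreal ((1 - 1 / (4 * \<kappa>)) ^ n)"
proof (rule tv_dist_leI)
  have \<pi>: "prob_space \<pi>" "sets \<pi> = sets (phase d)" using inv by (auto simp: invariant_law_def)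
  define \<rho> where "\<rho> = 1 - 1 / (4 * \<kappa>)"
  have \<rho>: "3 / 4 \<le> \<rho>" "\<rho> < 1" using \<kappa> by (simp_all add: \<rho>_def field_simps)
  fix A assume "A \<in> sets (P n z)"
  then have A: "A \<in> sets (phase d)" using z by simp
  let ?W = "1 + W2 d (return (phase d) z) \<pi>"
  show "ennreal \<bar>measure (P n z) A - measure \<pi> A\<bar> \<le> ennreal (8 * \<kappa>) * ?W * ennreal ((1 - 1 / (4 * \<kappa>)) ^ n)"
  proof (cases n)
    case 0
    have "measure (P n z) A \<le> 1" "measure \<pi> A \<le> 1"
      using P_prob[OF z] \<pi> by (simp_all add: prob_space.prob_le_1)
    moreover have "0 \<le> measure (P n z) A" "0 \<le> measure \<pi> A" by simp_all
    ultimately have "\<bar>measure (P n z) A - measure \<pi> A\<bar> \<le> 1" by linarith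
    then have "ennreal \<bar>measure (P n z) A - measure \<pi> A\<bar> \<le> 1 * 1" by (simp add: ennreal_le_1)
    also have "\<dots> \<le> ennreal (8 * \<kappa>) * ?W" using \<kappa> by (intro mult_mono) auto
    finally show ?thesis by (simp add: 0)
  next
    case (Suc m)
    have "(\<integral>\<^sup>+w. ennreal (weighted_dist d \<kappa> z w) \<partial>\<pi>) \<le> (\<integral>\<^sup>+w. ennreal 2 * ennreal (phase_dist d z w) \<partial>\<pi>)"
    proof (intro nn_integral_mono)
      fix w
      have "ennreal (weighted_dist d \<kappa> z w) \<le> ennreal (2 * phase_dist d z w)"
        using \<kappa> by (intro ennreal_leI weighted_dist_le) simp
      then show "ennreal (weighted_dist d \<kappa> z w) \<le> ennreal 2 * ennreal (phase_dist d z w)"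
        by (simp add: ennreal_mult')
    qed
    also have "\<dots> = ennreal 2 * (\<integral>\<^sup>+w. ennreal (phase_dist d z w) \<partial>\<pi>)"
    proof (rule nn_integral_cmult)
      have "phase_dist d z \<in> borel_measurable \<pi>"
        unfolding measurable_cong_sets[OF \<pi>(2) refl] by (rule phase_dist_measurable)
      then show "(\<lambda>w. ennreal (phase_dist d z w)) \<in> borel_measurable \<pi>" by measurable
    qed
    also have "\<dots> \<le> ennreal 2 * ?W"
      by (intro mult_left_mono expected_dist_le_W2 z \<pi>) auto
    finally have N: "(\<integral>\<^sup>+w. ennreal (weighted_dist d \<kappa> z w) \<partial>\<pi>) \<le> ennreal 2 * ?W" .
    have "ennreal \<bar>measure (P n z) A - measure \<pi> A\<bar>
        \<le> ennreal (3 * sqrt \<kappa> * \<rho> ^ m) * (\<integral>\<^sup>+w. ennreal (weighted_dist d \<kappa> z w) \<partial>\<pi>)"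
      using invariant_rate[OF inv z A, of m] by (simp add: Suc \<rho>_def)
    also have "\<dots> \<le> ennreal (3 * sqrt \<kappa> * \<rho> ^ m) * (ennreal 2 * ?W)"
      by (intro mult_left_mono N) auto
    also have "\<dots> = ennreal (6 * sqrt \<kappa> * \<rho> ^ m) * ?W"
    proof -
      have "ennreal (3 * sqrt \<kappa> * \<rho> ^ m) * ennreal 2 = ennreal (6 * sqrt \<kappa> * \<rho> ^ m)"
        using \<kappa> \<rho> by (subst ennreal_mult[symmetric]) auto
      then show ?thesis by (simp only: mult.assoc[symmetric])
    qed
    also have "\<dots> \<le> ennreal (8 * \<kappa> * \<rho> ^ n) * ?W"
    proof (intro mult_right_mono ennreal_leI)
      have "sqrt \<kappa> \<le> \<kappa>" using \<kappa> by (simp add: real_le_lsqrt real_sqrt_le_iff sqrt_le_D power2_eq_square)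
      then have "6 * sqrt \<kappa> * \<rho> ^ m \<le> (8 * (3 / 4)) * \<kappa> * \<rho> ^ m"
        using \<rho> by (intro mult_right_mono) auto
      also have "\<dots> = 8 * \<kappa> * \<rho> ^ m * (3 / 4)" by simp
      also have "\<dots> \<le> 8 * \<kappa> * \<rho> ^ m * \<rho>" using \<rho> \<kappa> by (intro mult_left_mono) auto
      finally show "6 * sqrt \<kappa> * \<rho> ^ m \<le> 8 * \<kappa> * \<rho> ^ n" by (simp add: Suc mult_ac)
    qed auto
    also have "\<dots> = ennreal (8 * \<kappa>) * ?W * ennreal (\<rho> ^ n)"
      using \<kappa> \<rho> by (simp add: ennreal_mult mult_ac)
    finally show ?thesis by (simp add: \<rho>_def)
  qed
qed

end

lemma rate_constant:
  fixes \<kappa> :: real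
  assumes "1 < \<kappa>"
  shows "(1 - 1 / (4 * \<kappa>)) ^ n \<le> exp (- ((1 / (128 * (1 - exp (- 1)))) * real n / \<kappa>))"
proof -
  have "(2::real) \<le> exp 1" using exp_ge_add_one_self[of 1] by simp
  then have "exp (- 1) \<le> (1 / 2 :: real)" by (simp add: exp_minus field_simps)
  then have c: "1 / (128 * (1 - exp (- 1))) \<le> (1 / 4 :: real)" by (simp add: field_simps)
  have "(1 - 1 / (4 * \<kappa>)) ^ n \<le> exp (- (1 / (4 * \<kappa>))) ^ n"
    using assms exp_ge_add_one_self[of "- (1 / (4 * \<kappa>))"] by (intro power_mono) (auto simp: field_simps)
  also have "\<dots> = exp (- (1 / 4 * (real n / \<kappa>)))" by (simp add: exp_of_nat_mult[symmetric])
  also have "\<dots> \<le> exp (- ((1 / (128 * (1 - exp (- 1)))) * (real n / \<kappa>)))"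
    using c assms by (simp only: exp_le_cancel_iff neg_le_iff_le) (intro mult_right_mono, auto)
  finally show ?thesis by simp
qed

text \<open>
  Since \<open>exp (- \<gamma> * h / 2) = K / (4 * L)\<close> for this rule, its value at \<open>(1, \<kappa>)\<close> is the tuning studied
  above. Its rate \<open>1 / 4\<close> and constant 8 are better than the stated ones.
\<close>
theorem theorem5p1:
  shows "\<exists>R :: tuning. tuning_rule R \<and> numerically_stable R \<and>
    (\<forall>\<kappa>::real. \<forall>d::nat. \<forall>U. \<kappa> > 1 \<longrightarrow> d \<ge> 1 \<longrightarrow> U \<in> U_class \<kappa> d \<longrightarrow>
      (let h = fst (R 1 \<kappa> d);
           \<gamma> = snd (R 1 \<kappa> d);
           Q = obabo_kernel d U h \<gamma>
       in \<exists>\<pi>. invariant_law (phase d) Q \<pi> \<and>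
              (\<forall>\<pi>'. invariant_law (phase d) Q \<pi>' \<longrightarrow> \<pi>' = \<pi>) \<and>
              (\<forall>z\<in>Rd d \<times> Rd d. \<forall>n::nat.
                 ennreal (tv_dist (push Q n (return (phase d) z)) \<pi>)
                 \<le> ennreal (143 * \<kappa>) * (1 + W2 d (return (phase d) z) \<pi>)
                   * ennreal (exp (- ((1 / (128 * (1 - exp (- 1)))) * real n / \<kappa>))))))"
proof -
  define R :: tuning where "R K L d = (1 / sqrt L, 2 * sqrt L * ln (4 * L / K))" for K L d
  have "tuning_rule R"
    unfolding tuning_rule_def R_def by (auto intro!: mult_pos_pos ln_gt_zero simp: field_simps)
  moreover have "numerically_stable R"
    unfolding numerically_stable_def R_def by (auto simp: divide_strict_right_mono)
  moreover have "\<exists>\<pi>. invariant_law (phase d) (obabo_kernel d U (fst (R 1 \<kappa> d)) (snd (R 1 \<kappa> d))) \<pi> \<and>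
      (\<forall>\<pi>'. invariant_law (phase d) (obabo_kernel d U (fst (R 1 \<kappa> d)) (snd (R 1 \<kappa> d))) \<pi>' \<longrightarrow> \<pi>' = \<pi>) \<and>
      (\<forall>z\<in>Rd d \<times> Rd d. \<forall>n::nat.
        ennreal (tv_dist (push (obabo_kernel d U (fst (R 1 \<kappa> d)) (snd (R 1 \<kappa> d))) n (return (phase d) z)) \<pi>)
        \<le> ennreal (143 * \<kappa>) * (1 + W2 d (return (phase d) z) \<pi>)
          * ennreal (exp (- ((1 / (128 * (1 - exp (- 1)))) * real n / \<kappa>))))"
    if \<kappa>: "1 < \<kappa>" and U: "U \<in> U_class \<kappa> d" for \<kappa> d U
  proof -
    define h where "h = fst (R 1 \<kappa> d)"
    define \<gamma> where "\<gamma> = snd (R 1 \<kappa> d)"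
    interpret tuned_obabo d U \<kappa> h \<gamma>
    proof
      show "exp (- \<gamma> * h / 2) = 1 / (4 * \<kappa>)"
        using \<kappa> by (simp add: h_def \<gamma>_def R_def exp_minus field_simps)
    qed (use \<kappa> U in \<open>auto simp: h_def R_def\<close>)
    obtain \<pi> where \<pi>: "invariant_law (phase d) Q \<pi>" by (rule invariant_exists)
    have "ennreal (tv_dist (push Q n (return (phase d) z)) \<pi>)
        \<le> ennreal (143 * \<kappa>) * (1 + W2 d (return (phase d) z) \<pi>)
          * ennreal (exp (- ((1 / (128 * (1 - exp (- 1)))) * real n / \<kappa>)))"
      if "z \<in> Rd d \<times> Rd d" for z n
    proof -
      have "ennreal (tv_dist (P n z) \<pi>)
          \<le> ennreal (8 * \<kappa>) * (1 + W2 d (return (phase d) z) \<pi>) * ennreal ((1 - 1 / (4 * \<kappa>)) ^ n)"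
        using that by (intro tv_rate \<pi>) (simp add: space_phase)
      also have "\<dots> \<le> ennreal (143 * \<kappa>) * (1 + W2 d (return (phase d) z) \<pi>)
          * ennreal (exp (- ((1 / (128 * (1 - exp (- 1)))) * real n / \<kappa>)))"
        using \<kappa> by (intro mult_mono ennreal_leI rate_constant) auto
      finally show ?thesis by (simp add: P_def)
    qed
    then show ?thesis
      unfolding h_def[symmetric] \<gamma>_def[symmetric] kernel_eq
      using \<pi> invariant_unique[OF \<pi>] by blast
  qed
  ultimately show ?thesis unfolding Let_def by blast
qed

end
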